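(* Let $\Bbbk$ be a field of characteristic $0$ and $n\ge3$. Let $q\in\Bbbk^\times$, let $N_q$ be the $q$-skew Nambu-Poisson field and let $K$ be another ($n$-Lie) Nambu-Poisson field. (1) If $\mathcal V_{-1}(K)\ne\emptyset$, then there is no Nambu-Poisson algebra morphism from $N_q$ to $K$. (2) If $K$ is either the Weyl Nambu-Poisson field $N_{Weyl}$ or the Nambu-Poisson field $Q(P_\Omega)$, where $\Omega\in\Bbbk[t_1,\dots,t_{n+1}]$ is an i.s. potential of degree $n+1+d_0$ with $d_0\ge0$ and $\deg\Omega\ne\sum_{s=1}^{n+1}\deg(t_s)=n+1$, then there is no Nambu-Poisson algebra morphism from $N_q$ to $K$.
   Context: A Nambu-Poisson algebra ($n$-Lie Poisson algebra) is a commutative $\Bbbk$-algebra $P$ with an $n$-ary $\Bbbk$-multilinear bracket $\{-,\dots,-\}$ that vanishes whenever two arguments are equal, satisfies $\{\{u_1,\dots,u_n\},v_1,\dots,v_{n-1}\}=\sum_{s=1}^n\{u_1,\dots,u_{s-1},\{u_s,v_1,\dots,v_{n-1}\},u_{s+1},\dots,u_n\}$, and satisfies the Leibniz rule in each argument. The bracket of a Nambu-Poisson domain $A$ extends uniquely to its fraction field $Q(A)$. Morphisms are (unital) $\Bbbk$-algebra maps preserving brackets. $N_q$ is $\Bbbk(t_1,\dots,t_n)$ with $\{t_1,\dots,t_n\}=q\,t_1\cdots t_n$; $N_{Weyl}$ is $\Bbbk(t_1,\dots,t_n)$ with $\{t_1,\dots,t_n\}=1$. For $w\in\mathbb Z$,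 a $w$-valuation on a Nambu-Poisson field $K$ is a map $\nu:K\to\mathbb Z\cup\{\infty\}$ such that for all $a,b,b_i\in K$: $\nu(a)=\infty$ iff $a=0$; $\nu(c)=0$ for $c\in\Bbbk^\times$; $\nu(ab)=\nu(a)+\nu(b)$; $\nu(a+b)\ge\min\{\nu(a),\nu(b)\}$ with equality if $\nu(a)\ne\nu(b)$; and $\nu(\{b_1,\dots,b_n\})\ge-w+\sum_{s=1}^n\nu(b_s)$. It is trivial if $\nu(a)=0$ for all $a\ne0$. $\mathcal V_w(K)$ is the set of nontrivial $w$-valuations on $K$. An i.s. potential is a homogeneous element $\Omega\in\Bbbk[t_1,\dots,t_{n+1}]$ (with $\deg t_i=1$ for all $i$) such that $\Bbbk[t_1,\dots,t_{n+1}]/(\Omega_{t_1},\dots,\Omega_{t_{n+1}})$ is finite-dimensional over $\Bbbk$, where $\Omega_{t_i}=\partial\Omega/\partial t_i$. $A_\Omega$ is $\Bbbk[t_1,\dots,t_{n+1}]$ with bracket $\{f_1,\dots,f_n\}=\det\frac{\partial(f_1,\dots,f_n,\Omega)}{\partial(t_1,\dots,t_{n+1})}$, and $P_\Omega=A_\Omega/(\Omega)$ with the induced bracket. *)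

theory Defs
  imports
    "Jordan_Normal_Form.Determinant"
    "HOL-Algebra.QuotRing"
    "HOL-Algebra.Module"
    "HOL-Library.Poly_Mapping"
    "HOL-Library.Extended"
    "HOL-Computational_Algebra.Fraction_Field"
begin

section \<open>Nambu-Poisson algebras\<close>

text \<open>The ground field is a type \<open>'k\<close>; the locale \<^locale>\<open>algebra\<close> wants it as a ring record.\<close>

definition ground_ring :: "'k::comm_ring_1 ring" where
  "ground_ring = \<lparr>carrier = UNIV, monoid.mult = (*), one = 1, zero = 0, add = (+)\<rparr>"

text \<open>The \<open>n\<close>-ary bracket takes the list of its arguments; it is meaningful only on lists of
  length \<open>n\<close>. The \<open>n\<close> argument slots are numbered from \<open>0\<close>.\<close>

record ('k, 'a) nambu = "('k, 'a) module" +
  bracket :: "'a list \<Rightarrow> 'a"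

locale nambu_poisson_algebra =
  algebra ground_ring P for n :: nat and P :: "('k::field, 'a) nambu" (structure) +
  assumes bracket_closed:
      "\<lbrakk>length us = n; set us \<subseteq> carrier P\<rbrakk> \<Longrightarrow> bracket P us \<in> carrier P"
    and bracket_add:
      "\<lbrakk>length us = n; set us \<subseteq> carrier P; i < n; x \<in> carrier P; y \<in> carrier P\<rbrakk> \<Longrightarrow>
       bracket P (us[i := x \<oplus> y]) = bracket P (us[i := x]) \<oplus> bracket P (us[i := y])"
    and bracket_smult:
      "\<lbrakk>length us = n; set us \<subseteq> carrier P; i < n; x \<in> carrier P\<rbrakk> \<Longrightarrow>
       bracket P (us[i := c \<odot>\<^bsub>P\<^esub> x]) = c \<odot>\<^bsub>P\<^esub> bracket P (us[i := x])"
    and bracket_alternating: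
      "\<lbrakk>length us = n; set us \<subseteq> carrier P; i < j; j < n; us ! i = us ! j\<rbrakk> \<Longrightarrow>
       bracket P us = \<zero>"
    and fundamental_identity:
      "\<lbrakk>length us = n; set us \<subseteq> carrier P; length vs = n - 1; set vs \<subseteq> carrier P\<rbrakk> \<Longrightarrow>
       bracket P (bracket P us # vs)
         = (\<Oplus>s\<in>{..<n}. bracket P (us[s := bracket P (us ! s # vs)]))"
    and bracket_Leibniz:
      "\<lbrakk>length us = n; set us \<subseteq> carrier P; i < n; x \<in> carrier P; y \<in> carrier P\<rbrakk> \<Longrightarrow>
       bracket P (us[i := x \<otimes> y])
         = x \<otimes> bracket P (us[i := y]) \<oplus> bracket P (us[i := x]) \<otimes> y"

locale nambu_poisson_field = nambu_poisson_algebra n P + field P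
  for n :: nat and P :: "('k::field, 'a) nambu" (structure)

definition nambu_hom ::
    "nat \<Rightarrow> ('k, 'a) nambu \<Rightarrow> ('k, 'b) nambu \<Rightarrow> ('a \<Rightarrow> 'b) set" where
  "nambu_hom n P Q = {\<phi> \<in> ring_hom P Q.
     (\<forall>c. \<forall>x\<in>carrier P. \<phi> (c \<odot>\<^bsub>P\<^esub> x) = c \<odot>\<^bsub>Q\<^esub> \<phi> x) \<and>
     (\<forall>us. length us = n \<and> set us \<subseteq> carrier P \<longrightarrow>
        \<phi> (bracket P us) = bracket Q (map \<phi> us))}"

text \<open>\<open>K\<close> is (a model of) the Nambu-Poisson field \<open>Q(A)\<close>: a Nambu-Poisson field containing \<open>A\<close>,
  whose bracket extends that of \<open>A\<close>, and all of whose elements are fractions of elements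
  of \<open>A\<close>.\<close>

definition is_nambu_fraction_field ::
    "nat \<Rightarrow> ('k::field, 'a) nambu \<Rightarrow> ('k, 'b) nambu \<Rightarrow> bool" where
  "is_nambu_fraction_field n A K \<longleftrightarrow> nambu_poisson_field n K \<and>
     (\<exists>\<iota>\<in>nambu_hom n A K. inj_on \<iota> (carrier A) \<and>
        (\<forall>x\<in>carrier K. \<exists>a\<in>carrier A. \<exists>b\<in>carrier A - {\<zero>\<^bsub>A\<^esub>}.
           x = \<iota> a \<otimes>\<^bsub>K\<^esub> inv\<^bsub>K\<^esub> (\<iota> b)))"

section \<open>Valuations\<close>

text \<open>The codomain \<open>\<int> \<union> {\<infinity>}\<close> is \<^typ>\<open>int extended\<close> without \<^const>\<open>Minf\<close>.
  Values outside the carrier are unconstrained.\<close>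

definition is_w_valuation ::
    "nat \<Rightarrow> int \<Rightarrow> ('k::field, 'a) nambu \<Rightarrow> ('a \<Rightarrow> int extended) \<Rightarrow> bool" where
  "is_w_valuation n w K \<nu> \<longleftrightarrow>
     \<nu> \<in> carrier K \<rightarrow> UNIV - {Minf} \<and>
     (\<forall>a\<in>carrier K. \<nu> a = Pinf \<longleftrightarrow> a = \<zero>\<^bsub>K\<^esub>) \<and>
     (\<forall>c. c \<noteq> 0 \<longrightarrow> \<nu> (c \<odot>\<^bsub>K\<^esub> \<one>\<^bsub>K\<^esub>) = 0) \<and>
     (\<forall>a\<in>carrier K. \<forall>b\<in>carrier K. \<nu> (a \<otimes>\<^bsub>K\<^esub> b) = \<nu> a + \<nu> b) \<and>
     (\<forall>a\<in>carrier K. \<forall>b\<in>carrier K. \<nu> (a \<oplus>\<^bsub>K\<^esub> b) \<ge> min (\<nu> a) (\<nu> b) \<and>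
        (\<nu> a \<noteq> \<nu> b \<longrightarrow> \<nu> (a \<oplus>\<^bsub>K\<^esub> b) = min (\<nu> a) (\<nu> b))) \<and>
     (\<forall>bs. length bs = n \<and> set bs \<subseteq> carrier K \<longrightarrow>
        \<nu> (bracket K bs) \<ge> Fin (- w) + sum_list (map \<nu> bs))"

definition nontrivial_valuations ::
    "nat \<Rightarrow> int \<Rightarrow> ('k::field, 'a) nambu \<Rightarrow> ('a \<Rightarrow> int extended) set" where
  "nontrivial_valuations n w K = {\<nu>. is_w_valuation n w K \<nu> \<and>
     \<not> (\<forall>a\<in>carrier K. a \<noteq> \<zero>\<^bsub>K\<^esub> \<longrightarrow> \<nu> a = 0)}"

section \<open>Polynomials and rational functions\<close>

text \<open>Polynomials in variables indexed by \<^typ>\<open>nat\<close>, as finitely supported maps from exponents to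
  coefficients. The paper's \<open>t\<^sub>1, \<dots>, t\<^sub>m\<close> are the variables \<open>0, \<dots>, m - 1\<close>, and the rings in
  these variables only are carved out by carriers.\<close>

type_synonym 'k mpoly = "(nat \<Rightarrow>\<^sub>0 nat) \<Rightarrow>\<^sub>0 'k"
type_synonym 'k ratfun = "((nat \<Rightarrow>\<^sub>0 nat) \<Rightarrow>\<^sub>0 'k) fract"

definition mvar :: "nat \<Rightarrow> 'k::comm_ring_1 mpoly" where
  "mvar i = Poly_Mapping.single (Poly_Mapping.single i 1) 1"

definition mconst :: "'k::comm_ring_1 \<Rightarrow> 'k mpoly" where
  "mconst c = Poly_Mapping.single 0 c"

definition mpoly_algebra :: "nat \<Rightarrow> ('k::comm_ring_1, 'k mpoly) module" where
  "mpoly_algebra m =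
     \<lparr>carrier = {p. \<forall>e\<in>Poly_Mapping.keys p. Poly_Mapping.keys e \<subseteq> {..<m}},
      monoid.mult = (*), one = 1, zero = 0, add = (+), module.smult = (\<lambda>c p. mconst c * p)\<rparr>"

definition ratfun_algebra :: "nat \<Rightarrow> ('k::field, 'k ratfun) module" where
  "ratfun_algebra m =
     \<lparr>carrier = {Fract p r | p r. p \<in> carrier (mpoly_algebra m) \<and>
                                r \<in> carrier (mpoly_algebra m) \<and> r \<noteq> 0},
      monoid.mult = (*), one = 1, zero = 0, add = (+), module.smult = (\<lambda>c x. Fract (mconst c) 1 * x)\<rparr>"

definition rvar :: "nat \<Rightarrow> 'k::field ratfun" where
  "rvar i = Fract (mvar i) 1"

text \<open>\<open>N\<close> is the field \<open>k(t\<^sub>1, \<dots>, t\<^sub>n)\<close> with the Nambu-Poisson bracket determined by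
  \<open>{t\<^sub>1, \<dots>, t\<^sub>n} = q t\<^sub>1 \<cdots> t\<^sub>n\<close>, respectively \<open>{t\<^sub>1, \<dots>, t\<^sub>n} = 1\<close>. An alternating
  multiderivation over \<open>k\<close> is determined by this value.\<close>

definition is_N_skew :: "nat \<Rightarrow> 'k::field \<Rightarrow> ('k, 'k ratfun) nambu \<Rightarrow> bool" where
  "is_N_skew n q N \<longleftrightarrow> nambu_poisson_field n N \<and> module.truncate N = ratfun_algebra n \<and>
     bracket N (map rvar [0..<n]) = Fract (mconst q) 1 * (\<Prod>i<n. rvar i)"

definition is_N_Weyl :: "nat \<Rightarrow> ('k::field, 'k ratfun) nambu \<Rightarrow> bool" where
  "is_N_Weyl n N \<longleftrightarrow> nambu_poisson_field n N \<and> module.truncate N = ratfun_algebra n \<and>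
     bracket N (map rvar [0..<n]) = 1"

definition nambu_isomorphic :: "nat \<Rightarrow> ('k, 'a) nambu \<Rightarrow> ('k, 'b) nambu \<Rightarrow> bool" where
  "nambu_isomorphic n P Q \<longleftrightarrow> (\<exists>\<phi>\<in>nambu_hom n P Q. bij_betw \<phi> (carrier P) (carrier Q))"

section \<open>The algebras of an i.s. potential\<close>

definition partial_deriv :: "nat \<Rightarrow> 'k::comm_ring_1 mpoly \<Rightarrow> 'k mpoly" where
  "partial_deriv i p = (\<Sum>e\<in>Poly_Mapping.keys p.
     Poly_Mapping.single (e - Poly_Mapping.single i 1)
       (of_nat (Poly_Mapping.lookup e i) * Poly_Mapping.lookup p e))"

definition exponent_degree :: "(nat \<Rightarrow>\<^sub>0 nat) \<Rightarrow> nat" where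
  "exponent_degree e = (\<Sum>i\<in>Poly_Mapping.keys e. Poly_Mapping.lookup e i)"

definition homogeneous :: "'k::zero mpoly \<Rightarrow> bool" where
  "homogeneous p \<longleftrightarrow> (\<exists>d. \<forall>e\<in>Poly_Mapping.keys p. exponent_degree e = d)"

definition total_degree :: "'k::zero mpoly \<Rightarrow> nat" where
  "total_degree p = Max (insert 0 (exponent_degree ` Poly_Mapping.keys p))"

text \<open>Scalar multiplication and bracket of the quotients are lifted to cosets in the same style
  as \<^const>\<open>rcoset_mult\<close>: the union of the cosets of the results over all representatives,
  which is a single coset when the operation is well defined modulo \<open>I\<close>.\<close>

definition quotient_algebra ::
    "('k, 'a, 'z) module_scheme \<Rightarrow> 'a set \<Rightarrow> ('k, 'a set) module" where
  "quotient_algebra P I =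
     ring.extend (P Quot I) (module.fields (\<lambda>c X. \<Union>x\<in>X. I +>\<^bsub>P\<^esub> (c \<odot>\<^bsub>P\<^esub> x)))"

definition quotient_nambu :: "('k, 'a) nambu \<Rightarrow> 'a set \<Rightarrow> ('k, 'a set) nambu" where
  "quotient_nambu P I =
     module.extend (quotient_algebra P I)
       (nambu.fields (\<lambda>Xs. \<Union>us\<in>{us. list_all2 (\<in>) us Xs}. I +>\<^bsub>P\<^esub> bracket P us))"

definition finite_dimensional :: "('k, 'a, 'z) module_scheme \<Rightarrow> bool" where
  "finite_dimensional M \<longleftrightarrow> (\<exists>B. finite B \<and> B \<subseteq> carrier M \<and>
     (\<forall>x\<in>carrier M. \<exists>c. x = (\<Oplus>\<^bsub>M\<^esub>b\<in>B. c b \<odot>\<^bsub>M\<^esub> b)))"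

definition is_potential :: "nat \<Rightarrow> 'k::field mpoly \<Rightarrow> bool" where
  "is_potential n \<Omega> \<longleftrightarrow> \<Omega> \<in> carrier (mpoly_algebra (n + 1)) \<and> homogeneous \<Omega> \<and>
     finite_dimensional (quotient_algebra (mpoly_algebra (n + 1))
       (Idl\<^bsub>mpoly_algebra (n + 1)\<^esub> ((\<lambda>i. partial_deriv i \<Omega>) ` {..<n + 1})))"

definition A_pot :: "nat \<Rightarrow> 'k::field mpoly \<Rightarrow> ('k, 'k mpoly) nambu" where
  "A_pot n \<Omega> =
     module.extend (mpoly_algebra (n + 1))
       (nambu.fields (\<lambda>fs. det (mat (n + 1) (n + 1)
          (\<lambda>(i, j). partial_deriv j ((fs @ [\<Omega>]) ! i)))))"

definition P_pot :: "nat \<Rightarrow> 'k::field mpoly \<Rightarrow> ('k, 'k mpoly set) nambu" where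
  "P_pot n \<Omega> = quotient_nambu (A_pot n \<Omega>) (PIdl\<^bsub>A_pot n \<Omega>\<^esub> \<Omega>)"

end

theory Submission
  imports Defs
begin

text \<open>Suppose that \<open>K\<close> carries a multiplicative filtration \<open>F\<close>, as given by a valuation, for which the bracket
  raises the total weight of its arguments by at least \<open>1\<close>. Then no nonzero \<open>x\<^sub>1, \<dots>, x\<^sub>n\<close> in \<open>K\<close> satisfy
  \<open>{x\<^sub>1, \<dots>, x\<^sub>n} = q x\<^sub>1 \<cdots> x\<^sub>n\<close>: dividing by the product would put the unit \<open>q\<close> into weight \<open>1\<close>.
  Since a morphism from \<open>N\<^sub>q\<close> is injective, it would produce such elements.

  A \<open>(-1)\<close>-valuation is such a filtration. The Weyl field and \<open>Q(P\<^sub>\<Omega>)\<close> are both fields of fractions of a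
  quotient of a polynomial ring by a homogeneous ideal, so giving all variables the same weight \<open>\<epsilon>\<close>
  filters them by leading forms. With \<open>\<epsilon> = -1\<close> the Weyl bracket of \<open>n\<close> variables has weight
  \<open>0 \<ge> n \<epsilon> + 1\<close>; with \<open>\<epsilon> = 1\<close> the bracket on \<open>P\<^sub>\<Omega>\<close> takes \<open>n\<close> variables to a form of weight
  \<open>deg \<Omega> - 1 \<ge> n + 1\<close>. By the Leibniz rule, the estimate for the variables implies the one for all
  elements.\<close>

section \<open>Filtered Nambu-Poisson fields\<close>

text \<open>The laws inherited from \<open>algebra\<close> range over the carrier of
  \<open>ground_ring\<close>. That carrier is the whole type, so the scalar rules hold for every
  \<open>k\<close>.\<close>

lemma (in nambu_poisson_algebra) scalar_closed: "x \<in> carrier P \<Longrightarrow> k \<odot>\<^bsub>P\<^esub> x \<in> carrier P"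
  using smult_closed[of k x] by (simp add: ground_ring_def)

lemma (in nambu_poisson_algebra) scalar_one: "x \<in> carrier P \<Longrightarrow> 1 \<odot>\<^bsub>P\<^esub> x = x"
  using smult_one[of x] by (simp add: ground_ring_def)

lemma (in nambu_poisson_algebra) scalar_zero: "x \<in> carrier P \<Longrightarrow> 0 \<odot>\<^bsub>P\<^esub> x = \<zero>"
  using smult_l_null[of x] by (simp add: ground_ring_def)

lemma (in nambu_poisson_algebra) scalar_minus_one: "x \<in> carrier P \<Longrightarrow> (- 1) \<odot>\<^bsub>P\<^esub> x = \<ominus> x"
proof -
  assume x: "x \<in> carrier P"
  have "(- 1) \<odot>\<^bsub>P\<^esub> x \<oplus> 1 \<odot>\<^bsub>P\<^esub> x = (- 1 + 1) \<odot>\<^bsub>P\<^esub> x"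
    using smult_l_distr[of "- 1" 1 x] x by (simp add: ground_ring_def)
  then show ?thesis using x by (simp add: scalar_one scalar_zero scalar_closed minus_equality)
qed

lemma prod_list_upt: "prod_list (map f [0..<k]) = (\<Prod>i<k. f i :: 'b::comm_monoid_mult)"
  by (induction k) (simp_all add: mult.commute)

text \<open>\<open>F c\<close> stands for the elements of value at least \<open>c\<close>.
  \<open>F_inv\<close> asserts a weight that is attained exactly, since the inverse has the opposite
  one. \<open>F_one\<close> bounds weights from above, and \<open>F_bracket\<close> is the bracket
  inequality of a valuation with \<open>w = -1\<close>.\<close>

locale nambu_filtration = nambu_poisson_field n K
  for n :: nat and K :: "('k::field, 'a) nambu" (structure) +
  fixes F :: "int \<Rightarrow> 'a set"
  assumes F_carrier: "F c \<subseteq> carrier K"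
    and F_mult: "\<lbrakk>x \<in> F a; y \<in> F b\<rbrakk> \<Longrightarrow> x \<otimes> y \<in> F (a + b)"
    and F_inv: "\<lbrakk>x \<in> carrier K; x \<noteq> \<zero>\<rbrakk> \<Longrightarrow> \<exists>c. x \<in> F c \<and> inv x \<in> F (- c)"
    and F_scalar: "k \<noteq> 0 \<Longrightarrow> k \<odot>\<^bsub>K\<^esub> \<one> \<in> F 0"
    and F_one: "\<one> \<notin> F 1"
    and F_bracket: "\<lbrakk>length us = n; list_all2 (\<lambda>u c. u \<in> F c) us cs\<rbrakk> \<Longrightarrow>
       bracket K us \<in> F (sum_list cs + 1)"
begin

text \<open>\<open>F_inv\<close> supplies the weights entry by entry, and the inverse of a product
  is the product of the inverses.\<close>

lemma list_weights:
  assumes "set us \<subseteq> carrier K - {\<zero>}"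
  shows "\<exists>cs. list_all2 (\<lambda>u c. u \<in> F c) us cs \<and> foldr (\<otimes>) us \<one> \<in> carrier K - {\<zero>} \<and>
    inv (foldr (\<otimes>) us \<one>) \<in> F (- sum_list cs)"
  using assms
proof (induction us)
  case Nil
  then show ?case using F_scalar[of 1] by (simp add: scalar_one)
next
  case (Cons u us)
  then obtain cs where cs: "list_all2 (\<lambda>u c. u \<in> F c) us cs"
      "foldr (\<otimes>) us \<one> \<in> carrier K - {\<zero>}" "inv (foldr (\<otimes>) us \<one>) \<in> F (- sum_list cs)"
    by auto
  have u: "u \<in> carrier K" "u \<noteq> \<zero>" using Cons.prems by auto
  then obtain c where c: "u \<in> F c" "inv u \<in> F (- c)" using F_inv by blast
  have "inv (u \<otimes> foldr (\<otimes>) us \<one>) = inv u \<otimes> inv (foldr (\<otimes>) us \<one>)"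
    using u cs(2) by (intro comm_inv_char) (auto simp: m_ac field_Units)
  then have "inv (foldr (\<otimes>) (u # us) \<one>) \<in> F (- sum_list (c # cs))"
    using F_mult[OF c(2) cs(3)] by simp
  then show ?case
    using u cs c by (intro exI[of _ "c # cs"]) (auto simp: integral_iff)
qed

text \<open>The bracket has weight \<open>sum_list cs + 1\<close> and the inverse of the product has
  weight \<open>- sum_list cs\<close>. Their product would be the scalar \<open>q\<close>, lying in
  \<open>F 1\<close>.\<close>

lemma no_log_volume:
  assumes "length us = n" "set us \<subseteq> carrier K - {\<zero>}" "q \<noteq> 0"
  shows "bracket K us \<noteq> (q \<odot>\<^bsub>K\<^esub> \<one>) \<otimes> foldr (\<otimes>) us \<one>"
proof
  let ?p = "foldr (\<otimes>) us \<one>"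
  assume eq: "bracket K us = (q \<odot>\<^bsub>K\<^esub> \<one>) \<otimes> ?p"
  obtain cs where cs: "list_all2 (\<lambda>u c. u \<in> F c) us cs" "?p \<in> carrier K" "?p \<noteq> \<zero>"
      "inv ?p \<in> F (- sum_list cs)"
    using list_weights[OF assms(2)] by auto
  have s: "c \<odot>\<^bsub>K\<^esub> \<one> \<in> carrier K" for c by (simp add: scalar_closed)
  have "bracket K us \<otimes> inv ?p \<in> F (sum_list cs + 1 + - sum_list cs)"
    by (rule F_mult[OF F_bracket[OF assms(1) cs(1)] cs(4)])
  moreover have "bracket K us \<otimes> inv ?p = q \<odot>\<^bsub>K\<^esub> \<one>"
    using eq s cs by (simp add: m_assoc field_Units)
  ultimately have "q \<odot>\<^bsub>K\<^esub> \<one> \<in> F 1" by simp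
  \<comment> \<open>Nonzero scalars have weight 0, so cancelling \<open>q\<close> keeps weight 1 and
    contradicts \<open>F_one\<close>.\<close>
  then have "(inverse q \<odot>\<^bsub>K\<^esub> \<one>) \<otimes> (q \<odot>\<^bsub>K\<^esub> \<one>) \<in> F 1"
    using F_mult[OF F_scalar[of "inverse q"]] assms(3) by fastforce
  moreover have "(inverse q \<odot>\<^bsub>K\<^esub> \<one>) \<otimes> (q \<odot>\<^bsub>K\<^esub> \<one>) = \<one>"
    using assms(3) smult_assoc1[of "inverse q" q \<one>] smult_one[of \<one>] s
    by (simp add: smult_assoc2 ground_ring_def)
  ultimately show False using F_one by simp
qed

text \<open>The images of the variables are nonzero and satisfy the equation that
  \<open>no_log_volume\<close> excludes.\<close>

lemma no_morphism_from_skew: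
  assumes "is_N_skew n q N" "q \<noteq> 0"
  shows "nambu_hom n N K = {}"
proof (rule ccontr)
  assume "nambu_hom n N K \<noteq> {}"
  then obtain \<phi> where \<phi>: "\<phi> \<in> nambu_hom n N K" by auto
  have tr: "module.truncate N = ratfun_algebra n" and N: "nambu_poisson_field n N"
    and br: "bracket N (map rvar [0..<n]) = Fract (mconst q) 1 * (\<Prod>i<n. rvar i)"
    using assms(1) by (auto simp: is_N_skew_def)
  interpret N: nambu_poisson_field n N by (rule N)
  have ops: "carrier N = carrier (ratfun_algebra n)" "monoid.mult N = (*)" "one N = 1" "zero N = 0"
    "module.smult N = (\<lambda>c x. Fract (mconst c) 1 * x)"
    using tr by (auto simp: module.truncate_def ratfun_algebra_def)
  interpret \<phi>: ring_hom_ring N K \<phi>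
    using \<phi> by unfold_locales (auto simp: nambu_hom_def)
  \<comment> \<open>Nonzero elements of a field are units, and a unital homomorphism into a field
    sends no unit to zero.\<close>
  have inj: "\<phi> x \<noteq> \<zero>" if "x \<in> carrier N" "x \<noteq> 0" for x
  proof
    assume 0: "\<phi> x = \<zero>"
    have x: "x \<in> Units N" using that N.field_Units ops by auto
    then have "\<phi> x \<otimes> \<phi> (inv\<^bsub>N\<^esub> x) = \<one>"
      by (metis \<phi>.hom_mult \<phi>.hom_one N.Units_r_inv N.Units_closed N.Units_inv_closed)
    then show False using 0 x by simp
  qed
  have var: "rvar i \<in> carrier N" "rvar i \<noteq> (0 :: 'k ratfun)" if "i < n" for i
  proof -
    have "(mvar i :: 'k mpoly) \<in> carrier (mpoly_algebra n)" "1 \<in> carrier (mpoly_algebra n :: ('k, 'k mpoly) module)"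
      using that by (auto simp: mpoly_algebra_def mvar_def)
    then show "rvar i \<in> carrier N" unfolding ops by (simp add: ratfun_algebra_def rvar_def) (metis zero_neq_one)
    have "(mvar i :: 'k mpoly) \<noteq> 0"
      unfolding mvar_def by (metis lookup_single_eq lookup_zero zero_neq_one)
    then show "rvar i \<noteq> (0 :: 'k ratfun)" by (simp add: rvar_def Zero_fract_def eq_fract)
  qed
  \<comment> \<open>Products in \<open>N\<close> are products of the type, while those in
    \<open>K\<close> are folds of the record operation; the induction passes from one to the
    other.\<close>
  have prod: "prod_list xs \<in> carrier N \<and> \<phi> (prod_list xs) = foldr (\<otimes>) (map \<phi> xs) \<one>"
    if "set xs \<subseteq> carrier N" for xs
    using that
  proof (induction xs)
    case Nil
    then show ?case using \<phi>.hom_one N.one_closed by (simp add: ops)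
  next
    case (Cons x xs)
    then show ?case using \<phi>.hom_mult[of x "prod_list xs"] N.m_closed[of x "prod_list xs"]
      by (simp add: ops(2))
  qed
  let ?us = "map \<phi> (map rvar [0..<n])"
  have c: "c \<odot>\<^bsub>N\<^esub> \<one>\<^bsub>N\<^esub> = Fract (mconst c) 1" for c
    by (simp add: ops)
  have cc: "c \<odot>\<^bsub>N\<^esub> \<one>\<^bsub>N\<^esub> \<in> carrier N" for c by (simp add: N.scalar_closed)
  have "bracket K ?us = \<phi> (bracket N (map rvar [0..<n]))"
  proof -
    have "set (map rvar [0..<n]) \<subseteq> carrier N" using var by auto
    then show ?thesis using \<phi> by (simp add: nambu_hom_def del: map_map)
  qed
  also have "bracket N (map rvar [0..<n]) = (q \<odot>\<^bsub>N\<^esub> \<one>\<^bsub>N\<^esub>) \<otimes>\<^bsub>N\<^esub> prod_list (map rvar [0..<n])"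
    by (simp add: br c ops(2) prod_list_upt)
  also have "\<phi> \<dots> = (q \<odot>\<^bsub>K\<^esub> \<one>) \<otimes> foldr (\<otimes>) ?us \<one>"
    using prod[of "map rvar [0..<n]"] var \<phi> cc
    by (subst \<phi>.hom_mult) (auto simp: nambu_hom_def image_subset_iff)
  finally have "bracket K ?us = (q \<odot>\<^bsub>K\<^esub> \<one>) \<otimes> foldr (\<otimes>) ?us \<one>" .
  moreover have "set ?us \<subseteq> carrier K - {\<zero>}" using var inj by auto
  ultimately show False using no_log_volume[of ?us q] assms(2) by simp
qed

end

text \<open>The superlevel sets of a valuation form the filtration. For nonzero \<open>x\<close> the
  weight required by \<open>F_inv\<close> is its finite value, because
  \<open>\<nu> (inv x) + \<nu> x = 0\<close>.\<close>

lemma (in nambu_poisson_field) valuation_filtration: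
  assumes "is_w_valuation n (- 1) P \<nu>"
  shows "nambu_filtration n P (\<lambda>c. {x \<in> carrier P. Fin c \<le> \<nu> x})"
proof
  have M: "\<nu> x \<noteq> Minf" and P: "\<nu> x = Pinf \<longleftrightarrow> x = \<zero>" if "x \<in> carrier P" for x
    using assms that unfolding is_w_valuation_def by auto
  have mult: "\<nu> (x \<otimes> y) = \<nu> x + \<nu> y" if "x \<in> carrier P" "y \<in> carrier P" for x y
    using assms that unfolding is_w_valuation_def by auto
  have c: "\<nu> (c \<odot>\<^bsub>P\<^esub> \<one>) = Fin 0" if "c \<noteq> 0" for c
    using assms that unfolding is_w_valuation_def by (simp add: zero_extended_def)
  have one: "\<nu> \<one> = Fin 0"
    using c[of 1] by (simp add: scalar_one)
  show "{x \<in> carrier P. Fin c \<le> \<nu> x} \<subseteq> carrier P" for c by auto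
  show "x \<otimes> y \<in> {x \<in> carrier P. Fin (a + b) \<le> \<nu> x}"
    if "x \<in> {x \<in> carrier P. Fin a \<le> \<nu> x}" "y \<in> {x \<in> carrier P. Fin b \<le> \<nu> x}" for x y a b
    using that M[of x] M[of y] mult[of x y] by (cases "\<nu> x"; cases "\<nu> y") auto
  show "\<exists>c. x \<in> {x \<in> carrier P. Fin c \<le> \<nu> x} \<and> inv x \<in> {x \<in> carrier P. Fin (- c) \<le> \<nu> x}"
    if x: "x \<in> carrier P" "x \<noteq> \<zero>" for x
  proof -
    obtain c where "\<nu> x = Fin c" using M[of x] P[of x] x by (cases "\<nu> x") auto
    moreover have "\<nu> (inv x) + \<nu> x = Fin 0" "inv x \<in> carrier P"
      using mult[of "inv x" x] x one field_Units by auto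
    moreover from this obtain d where "\<nu> (inv x) = Fin d"
      using M[of "inv x"] calculation(1) by (cases "\<nu> (inv x)") auto
    ultimately show ?thesis using x by (intro exI[of _ c]) auto
  qed
  show "c \<odot>\<^bsub>P\<^esub> \<one> \<in> {x \<in> carrier P. Fin 0 \<le> \<nu> x}" if "c \<noteq> 0" for c
    using c[OF that] by (simp add: scalar_closed)
  show "\<one> \<notin> {x \<in> carrier P. Fin 1 \<le> \<nu> x}" using one by simp
  show "bracket P us \<in> {x \<in> carrier P. Fin (sum_list cs + 1) \<le> \<nu> x}"
    if "length us = n" "list_all2 (\<lambda>u c. u \<in> {x \<in> carrier P. Fin c \<le> \<nu> x}) us cs" for us cs
  proof -
    have us: "set us \<subseteq> carrier P" using that(2) by (auto simp: list_all2_conv_all_nth in_set_conv_nth)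
    \<comment> \<open>Carrying the exclusion of \<open>Minf\<close> through the induction leaves
      only finite values and \<open>Pinf\<close> in the case splits, where addition respects the
      order.\<close>
    have "sum_list (map \<nu> us) \<noteq> Minf \<and> Fin (sum_list cs) \<le> sum_list (map \<nu> us)"
      using that(2)
    proof (induction rule: list_all2_induct)
      case Nil
      then show ?case by (simp add: zero_extended_def)
    next
      case (Cons u us c cs)
      then show ?case using M[of u]
        by (cases "\<nu> u"; cases "sum_list (map \<nu> us)") auto
    qed
    moreover have "Fin 1 + sum_list (map \<nu> us) \<le> \<nu> (bracket P us)"
      using assms that(1) us unfolding is_w_valuation_def by auto
    ultimately show ?thesis using bracket_closed[OF that(1) us]
      by (cases "sum_list (map \<nu> us)"; cases "\<nu> (bracket P us)") auto
  qed
qed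

section \<open>Polynomials graded by weight\<close>

text \<open>Splits the terms of \<open>p\<close> into two disjoint supports; with a condition on
  degrees as \<open>Q\<close>, this extracts a homogeneous component.\<close>

lemma mpoly_decompose:
  fixes p :: "'k::comm_ring_1 mpoly"
  obtains g h where "p = g + h" "Poly_Mapping.keys g = {e \<in> Poly_Mapping.keys p. Q e}"
    "Poly_Mapping.keys h = {e \<in> Poly_Mapping.keys p. \<not> Q e}"
proof
  let ?g = "Poly_Mapping.mapp (\<lambda>e c. c when Q e) p" and ?h = "Poly_Mapping.mapp (\<lambda>e c. c when \<not> Q e) p"
  show "p = ?g + ?h"
    by (rule poly_mapping_eqI) (auto simp: lookup_add lookup_mapp when_def in_keys_iff)
  show "Poly_Mapping.keys ?g = {e \<in> Poly_Mapping.keys p. Q e}"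
    "Poly_Mapping.keys ?h = {e \<in> Poly_Mapping.keys p. \<not> Q e}"
    by (auto simp: in_keys_iff lookup_mapp when_def split: if_splits)
qed

lemma sum_monomials:
  fixes p :: "'k::comm_ring_1 mpoly"
  shows "(\<Sum>e\<in>Poly_Mapping.keys p. Poly_Mapping.single e (Poly_Mapping.lookup p e)) = p"
  by (rule poly_mapping_eqI) (auto simp: lookup_sum lookup_single when_def in_keys_iff)

lemma exponent_degree_superset:
  assumes "finite S" "Poly_Mapping.keys e \<subseteq> S"
  shows "exponent_degree e = (\<Sum>i\<in>S. Poly_Mapping.lookup e i)"
  unfolding exponent_degree_def using assms
  by (intro sum.mono_neutral_left) (auto simp: in_keys_iff)

lemma exponent_degree_add: "exponent_degree (e + e') = exponent_degree e + exponent_degree e'"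
proof -
  let ?S = "Poly_Mapping.keys e \<union> Poly_Mapping.keys e'"
  have "Poly_Mapping.keys (e + e') \<subseteq> ?S" by (rule keys_add)
  then show ?thesis
    by (simp add: exponent_degree_superset[of ?S] lookup_add sum.distrib)
qed

lemma exponent_degree_simps [simp]:
  "exponent_degree 0 = 0" "exponent_degree (Poly_Mapping.single i k) = k"
  by (auto simp: exponent_degree_def)

text \<open>Peels one variable off a monomial, for inductions on the degree by the Leibniz
  rule.\<close>

lemma exponent_decompose:
  fixes e :: "nat \<Rightarrow>\<^sub>0 nat"
  assumes "e \<noteq> 0"
  obtains i e' where "e = Poly_Mapping.single i 1 + e'" "i \<in> Poly_Mapping.keys e"
    "Poly_Mapping.keys e' \<subseteq> Poly_Mapping.keys e"
proof -
  obtain i where i: "i \<in> Poly_Mapping.keys e" using assms by (metis equals0I keys_eq_empty)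
  let ?e = "e - Poly_Mapping.single i 1"
  have "e = Poly_Mapping.single i 1 + ?e"
    using i by (intro poly_mapping_eqI) (auto simp: lookup_add lookup_minus lookup_single when_def in_keys_iff)
  moreover have "Poly_Mapping.keys ?e \<subseteq> Poly_Mapping.keys e"
    by (auto simp: in_keys_iff lookup_minus)
  ultimately show ?thesis using that i by blast
qed

lemma mpoly_ops:
  "monoid.mult (mpoly_algebra m) = (*)" "one (mpoly_algebra m) = 1" "zero (mpoly_algebra m) = 0"
  "add (mpoly_algebra m) = (+)" "module.smult (mpoly_algebra m) = (\<lambda>c p. mconst c * p)"
  by (simp_all add: mpoly_algebra_def)

lemma mpoly_carrier:
  "p \<in> carrier (mpoly_algebra m) \<longleftrightarrow> (\<forall>e\<in>Poly_Mapping.keys p. Poly_Mapping.keys e \<subseteq> {..<m})"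
  by (simp add: mpoly_algebra_def)

lemma mpoly_closed:
  fixes p q :: "'k::comm_ring_1 mpoly"
  shows "0 \<in> carrier (mpoly_algebra m :: ('k, 'k mpoly) module)"
    "1 \<in> carrier (mpoly_algebra m :: ('k, 'k mpoly) module)"
    "mconst c \<in> carrier (mpoly_algebra m :: ('k, 'k mpoly) module)"
    "i < m \<Longrightarrow> mvar i \<in> carrier (mpoly_algebra m :: ('k, 'k mpoly) module)"
    "\<lbrakk>p \<in> carrier (mpoly_algebra m); q \<in> carrier (mpoly_algebra m)\<rbrakk> \<Longrightarrow> p + q \<in> carrier (mpoly_algebra m)"
    "\<lbrakk>p \<in> carrier (mpoly_algebra m); q \<in> carrier (mpoly_algebra m)\<rbrakk> \<Longrightarrow> p - q \<in> carrier (mpoly_algebra m)"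
    "\<lbrakk>p \<in> carrier (mpoly_algebra m); q \<in> carrier (mpoly_algebra m)\<rbrakk> \<Longrightarrow> p * q \<in> carrier (mpoly_algebra m)"
    "p \<in> carrier (mpoly_algebra m) \<Longrightarrow> - p \<in> carrier (mpoly_algebra m)"
proof -
  show "p + q \<in> carrier (mpoly_algebra m)"
    if "p \<in> carrier (mpoly_algebra m)" "q \<in> carrier (mpoly_algebra m)"
    using that keys_add[of p q] by (auto simp: mpoly_carrier)
  show "p - q \<in> carrier (mpoly_algebra m)"
    if "p \<in> carrier (mpoly_algebra m)" "q \<in> carrier (mpoly_algebra m)"
    using that keys_diff[of p q] by (auto simp: mpoly_carrier)
  show "p * q \<in> carrier (mpoly_algebra m)"
    if p: "p \<in> carrier (mpoly_algebra m)" and q: "q \<in> carrier (mpoly_algebra m)"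
    unfolding mpoly_carrier
  proof
    fix e assume "e \<in> Poly_Mapping.keys (p * q)"
    then obtain a b where "e = a + b" "a \<in> Poly_Mapping.keys p" "b \<in> Poly_Mapping.keys q"
      using keys_mult[of p q] by blast
    then show "Poly_Mapping.keys e \<subseteq> {..<m}" using p q keys_add[of a b] by (fastforce simp: mpoly_carrier)
  qed
  show "- p \<in> carrier (mpoly_algebra m)" if "p \<in> carrier (mpoly_algebra m)"
    using that by (auto simp: mpoly_carrier in_keys_iff)
qed (auto simp: mpoly_carrier mconst_def mvar_def)

text \<open>\<open>mpoly_ge\<close> prescribes a lower bound for all exponents of a polynomial when each variable has
  the weight \<open>\<epsilon>\<close>; with \<open>\<epsilon> = -1\<close> this is an upper bound for the degree.\<close>

definition mpoly_ge :: "nat \<Rightarrow> int \<Rightarrow> int \<Rightarrow> 'k::comm_ring_1 mpoly set" where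
  "mpoly_ge m \<epsilon> c = {p \<in> carrier (mpoly_algebra m).
     \<forall>e\<in>Poly_Mapping.keys p. c \<le> \<epsilon> * int (exponent_degree e)}"

text \<open>The zero polynomial belongs to every weight, so membership alone does not determine
  \<open>c\<close>.\<close>

definition mpoly_homog :: "nat \<Rightarrow> int \<Rightarrow> int \<Rightarrow> 'k::comm_ring_1 mpoly set" where
  "mpoly_homog m \<epsilon> c = {p \<in> carrier (mpoly_algebra m).
     \<forall>e\<in>Poly_Mapping.keys p. \<epsilon> * int (exponent_degree e) = c}"

lemma mpoly_graded_carrier:
  "p \<in> mpoly_ge m \<epsilon> c \<Longrightarrow> p \<in> carrier (mpoly_algebra m)"
  "p \<in> mpoly_homog m \<epsilon> c \<Longrightarrow> p \<in> carrier (mpoly_algebra m)"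
  by (auto simp: mpoly_ge_def mpoly_homog_def)

lemma mpoly_homog_ge: "p \<in> mpoly_homog m \<epsilon> c \<Longrightarrow> p \<in> mpoly_ge m \<epsilon> c"
  by (auto simp: mpoly_ge_def mpoly_homog_def)

lemma mpoly_ge_mono: "p \<in> mpoly_ge m \<epsilon> c \<Longrightarrow> d \<le> c \<Longrightarrow> p \<in> mpoly_ge m \<epsilon> d"
  by (force simp: mpoly_ge_def)

lemma mpoly_ge_add: "\<lbrakk>p \<in> mpoly_ge m \<epsilon> c; q \<in> mpoly_ge m \<epsilon> c\<rbrakk> \<Longrightarrow> p + q \<in> mpoly_ge m \<epsilon> c"
  using keys_add[of p q] by (auto simp: mpoly_ge_def mpoly_closed)

lemma mpoly_ge_diff: "\<lbrakk>p \<in> mpoly_ge m \<epsilon> c; q \<in> mpoly_ge m \<epsilon> c\<rbrakk> \<Longrightarrow> p - q \<in> mpoly_ge m \<epsilon> c"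
  using keys_diff[of p q] by (auto simp: mpoly_ge_def mpoly_closed)

lemma mpoly_ge_mult:
  assumes "p \<in> mpoly_ge m \<epsilon> c" "q \<in> mpoly_ge m \<epsilon> d"
  shows "p * q \<in> mpoly_ge m \<epsilon> (c + d)"
proof -
  have "c + d \<le> \<epsilon> * int (exponent_degree e)" if "e \<in> Poly_Mapping.keys (p * q)" for e
  proof -
    obtain a b where "e = a + b" "a \<in> Poly_Mapping.keys p" "b \<in> Poly_Mapping.keys q"
      using keys_mult[of p q] \<open>e \<in> _\<close> by blast
    then show ?thesis using assms
      by (auto simp: mpoly_ge_def exponent_degree_add distrib_left intro: add_mono)
  qed
  then show ?thesis using assms by (auto simp: mpoly_ge_def mpoly_closed)
qed

lemma mpoly_homog_mult:
  assumes "p \<in> mpoly_homog m \<epsilon> c" "q \<in> mpoly_homog m \<epsilon> d"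
  shows "p * q \<in> mpoly_homog m \<epsilon> (c + d)"
proof -
  have "\<epsilon> * int (exponent_degree e) = c + d" if "e \<in> Poly_Mapping.keys (p * q)" for e
  proof -
    obtain a b where "e = a + b" "a \<in> Poly_Mapping.keys p" "b \<in> Poly_Mapping.keys q"
      using keys_mult[of p q] \<open>e \<in> _\<close> by blast
    then show ?thesis using assms
      by (auto simp: mpoly_homog_def exponent_degree_add distrib_left)
  qed
  then show ?thesis using assms by (auto simp: mpoly_homog_def mpoly_closed)
qed

lemma mpoly_homog_const: "mconst k \<in> mpoly_homog m \<epsilon> 0"
  by (auto simp: mpoly_homog_def mpoly_closed) (simp add: mconst_def split: if_splits)

lemma mpoly_homog_var: "i < m \<Longrightarrow> mvar i \<in> mpoly_homog m \<epsilon> \<epsilon>"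
  by (auto simp: mpoly_homog_def mpoly_closed) (simp add: mvar_def split: if_splits)

section \<open>The filtration by leading forms\<close>

text \<open>\<open>K\<close> is the field of fractions of the image of a polynomial ring.
  \<open>graded_kernel\<close> expresses that the kernel is homogeneous: the lowest component
  \<open>g\<close> of an element \<open>g - h\<close> of the kernel is again in the kernel. Since
  \<open>int n * \<epsilon>\<close> is the total weight of \<open>n\<close> variables,
  \<open>bracket_vars\<close> says that the bracket raises weight by at least 1 on
  generators.\<close>

locale graded_presentation = nambu_poisson_field n K
  for n :: nat and K :: "('k::field, 'a) nambu" (structure) +
  fixes m :: nat and \<epsilon> :: int and \<pi> :: "'k mpoly \<Rightarrow> 'a"
  assumes \<pi>_ring_hom: "\<pi> \<in> ring_hom (mpoly_algebra m) K"
    and \<pi>_const: "\<pi> (mconst k) = k \<odot>\<^bsub>K\<^esub> \<one>"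
    and fractions: "x \<in> carrier K \<Longrightarrow> \<exists>p\<in>carrier (mpoly_algebra m). \<exists>q\<in>carrier (mpoly_algebra m).
       \<pi> q \<noteq> \<zero> \<and> x \<otimes> \<pi> q = \<pi> p"
    and graded_kernel: "\<lbrakk>g \<in> mpoly_homog m \<epsilon> d; h \<in> mpoly_ge m \<epsilon> (d + 1); \<pi> g = \<pi> h\<rbrakk> \<Longrightarrow> \<pi> g = \<zero>"
    and bracket_vars: "\<lbrakk>length js = n; set js \<subseteq> {..<m}\<rbrakk> \<Longrightarrow>
       \<exists>p\<in>mpoly_ge m \<epsilon> (int n * \<epsilon> + 1). bracket K (map (\<lambda>j. \<pi> (mvar j)) js) = \<pi> p"
begin

lemma \<pi>_simps [simp]:
  "p \<in> carrier (mpoly_algebra m) \<Longrightarrow> \<pi> p \<in> carrier K"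
  "\<lbrakk>p \<in> carrier (mpoly_algebra m); q \<in> carrier (mpoly_algebra m)\<rbrakk> \<Longrightarrow> \<pi> (p + q) = \<pi> p \<oplus> \<pi> q"
  "\<lbrakk>p \<in> carrier (mpoly_algebra m); q \<in> carrier (mpoly_algebra m)\<rbrakk> \<Longrightarrow> \<pi> (p * q) = \<pi> p \<otimes> \<pi> q"
  "\<pi> 1 = \<one>" "\<pi> 0 = \<zero>"
proof -
  show "\<pi> p \<in> carrier K" if "p \<in> carrier (mpoly_algebra m)"
    using \<pi>_ring_hom that by (rule ring_hom_closed)
  show "\<pi> (p + q) = \<pi> p \<oplus> \<pi> q" if "p \<in> carrier (mpoly_algebra m)" "q \<in> carrier (mpoly_algebra m)"
    using ring_hom_add[OF \<pi>_ring_hom that] by (simp add: mpoly_ops)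
  show "\<pi> (p * q) = \<pi> p \<otimes> \<pi> q" if "p \<in> carrier (mpoly_algebra m)" "q \<in> carrier (mpoly_algebra m)"
    using ring_hom_mult[OF \<pi>_ring_hom that] by (simp add: mpoly_ops)
  show "\<pi> 1 = \<one>" using ring_hom_one[OF \<pi>_ring_hom] by (simp add: mpoly_ops)
  show "\<pi> 0 = \<zero>" using \<pi>_const[of 0] scalar_zero by (simp add: mconst_def)
qed

section \<open>Elements of exact weight and the filtration of their fractions\<close>

text \<open>Images of polynomials whose component of lowest weight \<open>d\<close> survives in
  \<open>K\<close>; these serve as denominators of known weight.\<close>

definition exact :: "int \<Rightarrow> 'a set" where
  "exact d = {\<pi> (g + h) | g h. g \<in> mpoly_homog m \<epsilon> d \<and> h \<in> mpoly_ge m \<epsilon> (d + 1) \<and> \<pi> g \<noteq> \<zero>}"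

text \<open>A fraction has weight at least \<open>c\<close> if one denominator \<open>y\<close> of
  exact weight \<open>d\<close> carries it to a numerator of weight at least \<open>c + d\<close>.
  Quantifying over \<open>d\<close> and \<open>y\<close> avoids choosing a representation of the
  fraction.\<close>

definition frac_filtration :: "int \<Rightarrow> 'a set" where
  "frac_filtration c = {x \<in> carrier K. \<exists>d. \<exists>y\<in>exact d. x \<otimes> y \<in> \<pi> ` mpoly_ge m \<epsilon> (c + d)}"

lemma exact_image: "y \<in> exact d \<Longrightarrow> y \<in> \<pi> ` mpoly_ge m \<epsilon> d"
  unfolding exact_def by (auto intro!: imageI mpoly_ge_add intro: mpoly_homog_ge mpoly_ge_mono[of _ _ _ "d + 1"])

lemma image_carrier: "y \<in> \<pi> ` mpoly_ge m \<epsilon> d \<Longrightarrow> y \<in> carrier K"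
  by (auto simp: mpoly_graded_carrier)

lemma exact_carrier: "y \<in> exact d \<Longrightarrow> y \<in> carrier K"
  using exact_image image_carrier by blast

text \<open>A second representative \<open>p\<close> of higher weight would give
  \<open>\<pi> g = \<pi> (p - h)\<close> with \<open>p - h\<close> of weight at least
  \<open>d + 1\<close>, and homogeneity of the kernel would force \<open>\<pi> g\<close> to vanish.
  This makes the exact weight well defined.\<close>

lemma exact_not_image:
  assumes "y \<in> exact d"
  shows "y \<notin> \<pi> ` mpoly_ge m \<epsilon> (d + 1)"
proof
  assume "y \<in> \<pi> ` mpoly_ge m \<epsilon> (d + 1)"
  then obtain p where p: "p \<in> mpoly_ge m \<epsilon> (d + 1)" "y = \<pi> p" by auto
  obtain g h where gh: "y = \<pi> (g + h)" "g \<in> mpoly_homog m \<epsilon> d" "h \<in> mpoly_ge m \<epsilon> (d + 1)" "\<pi> g \<noteq> \<zero>"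
    using assms by (auto simp: exact_def)
  have car: "g \<in> carrier (mpoly_algebra m)" "h \<in> carrier (mpoly_algebra m)" "p \<in> carrier (mpoly_algebra m)"
    using p gh by (auto simp: mpoly_graded_carrier)
  have "\<pi> g \<oplus> \<pi> h = \<pi> (p - h) \<oplus> \<pi> h"
    using p(2) gh(1) car \<pi>_simps(2)[of "p - h" h] by (simp add: mpoly_closed)
  then have "\<pi> g = \<pi> (p - h)" using car by (simp add: mpoly_closed)
  moreover have "p - h \<in> mpoly_ge m \<epsilon> (d + 1)" using p gh by (intro mpoly_ge_diff)
  ultimately show False using graded_kernel gh by blast
qed

text \<open>The lowest components multiply, and the image of their product is nonzero because
  \<open>K\<close> is a domain.\<close>

lemma exact_mult:
  assumes "x \<in> exact a" "y \<in> exact b"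
  shows "x \<otimes> y \<in> exact (a + b)"
proof -
  obtain g h where x: "x = \<pi> (g + h)" "g \<in> mpoly_homog m \<epsilon> a" "h \<in> mpoly_ge m \<epsilon> (a + 1)" "\<pi> g \<noteq> \<zero>"
    using assms by (auto simp: exact_def)
  obtain g' h' where y: "y = \<pi> (g' + h')" "g' \<in> mpoly_homog m \<epsilon> b" "h' \<in> mpoly_ge m \<epsilon> (b + 1)" "\<pi> g' \<noteq> \<zero>"
    using assms by (auto simp: exact_def)
  note car = mpoly_graded_carrier(2)[OF x(2)] mpoly_graded_carrier(1)[OF x(3)]
    mpoly_graded_carrier(2)[OF y(2)] mpoly_graded_carrier(1)[OF y(3)]
  have "x \<otimes> y = \<pi> ((g + h) * (g' + h'))"
    unfolding x y using car by (subst \<pi>_simps(3)) (auto simp: mpoly_closed)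
  also have "(g + h) * (g' + h') = g * g' + (g * h' + h * (g' + h'))" by (simp add: algebra_simps)
  finally have "x \<otimes> y = \<pi> (g * g' + (g * h' + h * (g' + h')))" .
  moreover have "g * h' \<in> mpoly_ge m \<epsilon> (a + b + 1)"
    using mpoly_ge_mult[OF mpoly_homog_ge[OF x(2)] y(3)] by (simp add: add.assoc)
  moreover have "h * (g' + h') \<in> mpoly_ge m \<epsilon> (a + 1 + b)"
    using x y by (intro mpoly_ge_mult mpoly_ge_add) (auto intro: mpoly_homog_ge mpoly_ge_mono)
  ultimately show ?thesis
    unfolding exact_def using mpoly_homog_mult[OF x(2) y(2)] x(4) y(4) car
    by (intro CollectI exI[of _ "g * g'"] exI[of _ "g * h' + h * (g' + h')"])
       (auto simp: integral_iff intro!: mpoly_ge_add ac_simps elim: mpoly_ge_mono)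
qed

lemma exact_nonzero: "y \<in> exact d \<Longrightarrow> y \<noteq> \<zero>"
proof
  assume "y \<in> exact d" "y = \<zero>"
  moreover have "0 \<in> mpoly_ge m \<epsilon> (d + 1)" by (auto simp: mpoly_ge_def mpoly_closed)
  ultimately show False using exact_not_image[of y d] \<pi>_simps(5) by (metis imageI)
qed

text \<open>The image of a nonzero constant has an inverse, hence is nonzero; the remainder
  \<open>h\<close> is 0.\<close>

lemma exact_const: "k \<noteq> 0 \<Longrightarrow> k \<odot>\<^bsub>K\<^esub> \<one> \<in> exact 0"
proof -
  assume k: "k \<noteq> 0"
  have "\<pi> (mconst (inverse k) * mconst k) = \<one>"
    using k by (simp add: mconst_def mult_single del: \<pi>_simps(3))
  then have "\<pi> (mconst k) \<noteq> \<zero>"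
    by (metis \<pi>_simps(1,3) mpoly_closed(3) r_null zero_not_one)
  moreover have "0 \<in> mpoly_ge m \<epsilon> 1" by (auto simp: mpoly_ge_def mpoly_closed)
  moreover have "k \<odot>\<^bsub>K\<^esub> \<one> = \<pi> (mconst k + 0)" by (simp add: \<pi>_const)
  ultimately show ?thesis unfolding exact_def using mpoly_homog_const[of k m \<epsilon>] by fastforce
qed

text \<open>If the component of lowest weight dies in \<open>K\<close>, it is discarded without
  changing the image. The number of terms drops each time, so a surviving component is reached
  eventually.\<close>

lemma exact_exists:
  assumes "p \<in> carrier (mpoly_algebra m)" "\<pi> p \<noteq> \<zero>"
  shows "\<exists>d. \<pi> p \<in> exact d"
  using assms
proof (induction "card (Poly_Mapping.keys p)" arbitrary: p rule: less_induct)
  case less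
  let ?w = "\<lambda>e. \<epsilon> * int (exponent_degree e)"
  define d where "d = Min (?w ` Poly_Mapping.keys p)"
  have "p \<noteq> 0" using less.prems(2) by auto
  then have ne: "?w ` Poly_Mapping.keys p \<noteq> {}" by simp
  obtain g h where gh: "p = g + h" "Poly_Mapping.keys g = {e \<in> Poly_Mapping.keys p. ?w e = d}"
    "Poly_Mapping.keys h = {e \<in> Poly_Mapping.keys p. \<not> ?w e = d}"
    using mpoly_decompose[of p "\<lambda>e. ?w e = d"] by blast
  have g: "g \<in> mpoly_homog m \<epsilon> d" using less.prems gh by (auto simp: mpoly_homog_def mpoly_carrier)
  have ge: "d \<le> ?w e" if "e \<in> Poly_Mapping.keys p" for e
    unfolding d_def using that by (intro Min_le) auto
  then have h: "h \<in> mpoly_ge m \<epsilon> (d + 1)"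
    using less.prems gh ge by (force simp: mpoly_ge_def mpoly_carrier)
  show ?case
  proof (cases "\<pi> g = \<zero>")
    case False
    then show ?thesis using g h gh(1) unfolding exact_def by blast
  next
    case True
    then have eq: "\<pi> p = \<pi> h" using g h gh(1) by (simp add: mpoly_graded_carrier)
    have "d \<in> ?w ` Poly_Mapping.keys p" unfolding d_def using ne by (intro Min_in) auto
    then have "Poly_Mapping.keys h \<subset> Poly_Mapping.keys p" unfolding gh(3) by auto
    then have "card (Poly_Mapping.keys h) < card (Poly_Mapping.keys p)" by (intro psubset_card_mono) auto
    then show ?thesis using less.hyps[of h] eq less.prems h by (simp add: mpoly_graded_carrier)
  qed
qed

lemma frac_carrier: "x \<in> frac_filtration c \<Longrightarrow> x \<in> carrier K"
  by (simp add: frac_filtration_def)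

lemma exact_one: "\<one> \<in> exact 0"
  using exact_const[of 1] by (simp add: scalar_one)

lemma image_frac: "y \<in> \<pi> ` mpoly_ge m \<epsilon> c \<Longrightarrow> y \<in> frac_filtration c"
  unfolding frac_filtration_def using exact_one image_carrier[of y c]
  by (intro CollectI conjI exI[of _ 0] bexI[of _ \<one>]) auto

lemma image_mult:
  "\<lbrakk>x \<in> \<pi> ` mpoly_ge m \<epsilon> a; y \<in> \<pi> ` mpoly_ge m \<epsilon> b\<rbrakk> \<Longrightarrow> x \<otimes> y \<in> \<pi> ` mpoly_ge m \<epsilon> (a + b)"
  using mpoly_ge_mult by (force simp: mpoly_graded_carrier simp flip: \<pi>_simps(3))

lemma image_add:
  "\<lbrakk>x \<in> \<pi> ` mpoly_ge m \<epsilon> a; y \<in> \<pi> ` mpoly_ge m \<epsilon> a\<rbrakk> \<Longrightarrow> x \<oplus> y \<in> \<pi> ` mpoly_ge m \<epsilon> a"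
  using mpoly_ge_add by (force simp: mpoly_graded_carrier simp flip: \<pi>_simps(2))

lemma frac_mult:
  assumes "x \<in> frac_filtration a" "y \<in> frac_filtration b"
  shows "x \<otimes> y \<in> frac_filtration (a + b)"
proof -
  obtain d u where x: "x \<in> carrier K" "u \<in> exact d" "x \<otimes> u \<in> \<pi> ` mpoly_ge m \<epsilon> (a + d)"
    using assms(1) by (auto simp: frac_filtration_def)
  obtain e v where y: "y \<in> carrier K" "v \<in> exact e" "y \<otimes> v \<in> \<pi> ` mpoly_ge m \<epsilon> (b + e)"
    using assms(2) by (auto simp: frac_filtration_def)
  have "(x \<otimes> y) \<otimes> (u \<otimes> v) = (x \<otimes> u) \<otimes> (y \<otimes> v)"
    using x y by (simp add: m_ac exact_carrier)
  then have "(x \<otimes> y) \<otimes> (u \<otimes> v) \<in> \<pi> ` mpoly_ge m \<epsilon> (a + b + (d + e))"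
    using image_mult[OF x(3) y(3)] by (simp add: ac_simps)
  then show ?thesis unfolding frac_filtration_def using exact_mult[OF x(2) y(2)] x y by blast
qed

text \<open>Both fractions are brought over the common denominator \<open>u \<otimes> v\<close>,
  whose weight is exact by \<open>exact_mult\<close>.\<close>

lemma frac_add:
  assumes "x \<in> frac_filtration a" "y \<in> frac_filtration a"
  shows "x \<oplus> y \<in> frac_filtration a"
proof -
  obtain d u where x: "x \<in> carrier K" "u \<in> exact d" "x \<otimes> u \<in> \<pi> ` mpoly_ge m \<epsilon> (a + d)"
    using assms(1) by (auto simp: frac_filtration_def)
  obtain e v where y: "y \<in> carrier K" "v \<in> exact e" "y \<otimes> v \<in> \<pi> ` mpoly_ge m \<epsilon> (a + e)"
    using assms(2) by (auto simp: frac_filtration_def)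
  have "(x \<oplus> y) \<otimes> (u \<otimes> v) = (x \<otimes> u) \<otimes> v \<oplus> (y \<otimes> v) \<otimes> u"
    using x(1,2) y(1,2) by (simp add: m_ac r_distr exact_carrier)
  moreover have "(x \<otimes> u) \<otimes> v \<in> \<pi> ` mpoly_ge m \<epsilon> (a + (d + e))"
    using image_mult[OF x(3) exact_image[OF y(2)]] by (simp add: ac_simps)
  moreover have "(y \<otimes> v) \<otimes> u \<in> \<pi> ` mpoly_ge m \<epsilon> (a + (d + e))"
    using image_mult[OF y(3) exact_image[OF x(2)]] by (simp add: ac_simps)
  ultimately have "(x \<oplus> y) \<otimes> (u \<otimes> v) \<in> \<pi> ` mpoly_ge m \<epsilon> (a + (d + e))"
    using image_add by simp
  then show ?thesis unfolding frac_filtration_def using exact_mult[OF x(2) y(2)] x y by blast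
qed

lemma frac_zero: "\<zero> \<in> frac_filtration c"
proof -
  have "0 \<in> mpoly_ge m \<epsilon> c" by (auto simp: mpoly_ge_def mpoly_closed)
  then show ?thesis using image_frac[of \<zero> c] \<pi>_simps(5) by (metis imageI)
qed

lemma frac_minus:
  assumes "x \<in> frac_filtration c"
  shows "\<ominus> x \<in> frac_filtration c"
proof -
  have "((- 1) \<odot>\<^bsub>K\<^esub> \<one>) \<otimes> x \<in> frac_filtration (0 + c)"
    using image_frac[OF exact_image[OF exact_const[of "- 1"]]] assms by (intro frac_mult) auto
  moreover have "((- 1) \<odot>\<^bsub>K\<^esub> \<one>) \<otimes> x = \<ominus> x"
    using frac_carrier[OF assms] by (simp add: scalar_minus_one l_minus)
  ultimately show ?thesis by simp
qed

text \<open>The element itself is the denominator: \<open>inv y \<otimes> y\<close> is 1, of weight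
  \<open>0 = - d + d\<close>.\<close>

lemma exact_inv: "y \<in> exact d \<Longrightarrow> inv y \<in> frac_filtration (- d)"
proof -
  assume y: "y \<in> exact d"
  then have "y \<in> Units K" using exact_nonzero exact_carrier field_Units by auto
  then show ?thesis
    unfolding frac_filtration_def using y exact_image[OF exact_one] by (auto intro!: exI[of _ d] bexI[of _ y])
qed

text \<open>Writing \<open>x\<close> as a quotient of images with exact weights \<open>a\<close> and
  \<open>d\<close>, the fraction has weight \<open>a - d\<close> and its reciprocal
  \<open>d - a\<close>.\<close>

lemma frac_inv:
  assumes "x \<in> carrier K" "x \<noteq> \<zero>"
  shows "\<exists>c. x \<in> frac_filtration c \<and> inv x \<in> frac_filtration (- c)"
proof -
  obtain p q where pq: "p \<in> carrier (mpoly_algebra m)" "q \<in> carrier (mpoly_algebra m)" "\<pi> q \<noteq> \<zero>" "x \<otimes> \<pi> q = \<pi> p"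
    using fractions[OF assms(1)] by blast
  have "\<pi> p \<noteq> \<zero>" using pq assms by (metis \<pi>_simps(1) integral_iff)
  then obtain a d where ad: "\<pi> p \<in> exact a" "\<pi> q \<in> exact d" using exact_exists pq by meson
  have "x \<in> frac_filtration (a - d)"
    unfolding frac_filtration_def using assms(1) pq(4) ad exact_image[OF ad(1)]
    by (intro CollectI conjI exI[of _ d] bexI[of _ "\<pi> q"]) auto
  moreover have "inv x \<otimes> \<pi> p = \<pi> q"
    using pq assms field_Units by (simp flip: pq(4) m_assoc)
  then have "inv x \<in> frac_filtration (d - a)"
    unfolding frac_filtration_def using assms ad exact_image[OF ad(2)] field_Units
    by (intro CollectI conjI exI[of _ a] bexI[of _ "\<pi> p"]) auto
  ultimately show ?thesis by (intro exI[of _ "a - d"]) simp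
qed

text \<open>Weight 1 for the unit would put some \<open>y\<close> of exact weight \<open>d\<close>
  into the image of weight \<open>d + 1\<close>.\<close>

lemma frac_one: "\<one> \<notin> frac_filtration 1"
proof
  assume "\<one> \<in> frac_filtration 1"
  then obtain d y where "y \<in> exact d" "\<one> \<otimes> y \<in> \<pi> ` mpoly_ge m \<epsilon> (1 + d)"
    by (auto simp: frac_filtration_def)
  then show False using exact_not_image[of y d] exact_carrier[of y d] by (simp add: add.commute)
qed

section \<open>Derivations and brackets on the filtration\<close>

lemma monomial_graded:
  assumes "Poly_Mapping.keys e \<subseteq> {..<m}"
  shows "Poly_Mapping.single e k \<in> mpoly_homog m \<epsilon> (\<epsilon> * int (exponent_degree e))"
  using assms by (auto simp: mpoly_homog_def mpoly_carrier split: if_splits)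

text \<open>\<open>c\<close> is the amount by which \<open>D\<close> raises the weight of a
  variable. Induction on the degree splits off one variable; in both Leibniz terms exactly one
  factor is differentiated, so the gain \<open>c\<close> occurs once.\<close>

lemma derivation_monomial:
  assumes D_closed: "\<And>x. x \<in> carrier K \<Longrightarrow> D x \<in> carrier K"
    and D_mult: "\<And>x y. \<lbrakk>x \<in> carrier K; y \<in> carrier K\<rbrakk> \<Longrightarrow> D (x \<otimes> y) = x \<otimes> D y \<oplus> D x \<otimes> y"
    and D_scalar: "\<And>k x. x \<in> carrier K \<Longrightarrow> D (k \<odot>\<^bsub>K\<^esub> x) = k \<odot>\<^bsub>K\<^esub> D x"
    and D_var: "\<And>j. j < m \<Longrightarrow> D (\<pi> (mvar j)) \<in> frac_filtration (\<epsilon> + c)"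
    and e: "Poly_Mapping.keys e \<subseteq> {..<m}"
  shows "D (\<pi> (Poly_Mapping.single e k)) \<in> frac_filtration (\<epsilon> * int (exponent_degree e) + c)"
  using e
proof (induction "exponent_degree e" arbitrary: e rule: less_induct)
  case less
  show ?case
  proof (cases "e = 0")
    case True
    \<comment> \<open>The Leibniz rule for \<open>1 = 1 * 1\<close> gives \<open>D 1 = 0\<close>, so
      constants have derivative zero, which has every weight.\<close>
    have "D \<one> = \<one> \<otimes> D \<one> \<oplus> D \<one> \<otimes> \<one>" using D_mult[of \<one> \<one>] by simp
    then have "D \<one> = \<zero>" using D_closed[of \<one>] by simp
    then have "D (\<pi> (mconst k)) = \<zero>"
      using D_scalar[of \<one> k] smult_r_null[of k] by (simp add: \<pi>_const ground_ring_def)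
    then show ?thesis using True frac_zero by (simp add: mconst_def)
  next
    case False
    then obtain i e' where e': "e = Poly_Mapping.single i 1 + e'" "i \<in> Poly_Mapping.keys e"
      "Poly_Mapping.keys e' \<subseteq> Poly_Mapping.keys e" by (rule exponent_decompose)
    define s where "s = (Poly_Mapping.single e' k :: 'k mpoly)"
    have deg: "exponent_degree e = 1 + exponent_degree e'" by (simp add: e'(1) exponent_degree_add)
    have i: "i < m" and ke': "Poly_Mapping.keys e' \<subseteq> {..<m}" using less.prems e' by auto
    have IH: "D (\<pi> s) \<in> frac_filtration (\<epsilon> * int (exponent_degree e') + c)"
      unfolding s_def using less.hyps[of e'] deg ke' by simp
    have s: "s \<in> mpoly_ge m \<epsilon> (\<epsilon> * int (exponent_degree e'))"
      unfolding s_def using monomial_graded[OF ke'] by (rule mpoly_homog_ge)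
    have v: "(mvar i :: 'k mpoly) \<in> mpoly_ge m \<epsilon> \<epsilon>" using mpoly_homog_var[OF i] by (rule mpoly_homog_ge)
    have "Poly_Mapping.single e k = mvar i * s"
      by (simp add: s_def mvar_def mult_single e'(1))
    then have "D (\<pi> (Poly_Mapping.single e k)) = \<pi> (mvar i) \<otimes> D (\<pi> s) \<oplus> D (\<pi> (mvar i)) \<otimes> \<pi> s"
      using mpoly_graded_carrier(1)[OF v] mpoly_graded_carrier(1)[OF s] by (simp add: D_mult)
    also have "\<dots> \<in> frac_filtration (\<epsilon> * int (exponent_degree e) + c)"
    proof (rule frac_add)
      show "\<pi> (mvar i) \<otimes> D (\<pi> s) \<in> frac_filtration (\<epsilon> * int (exponent_degree e) + c)"
        using frac_mult[OF image_frac[OF imageI[OF v]] IH] by (simp add: deg algebra_simps)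
      show "D (\<pi> (mvar i)) \<otimes> \<pi> s \<in> frac_filtration (\<epsilon> * int (exponent_degree e) + c)"
        using frac_mult[OF D_var[OF i] image_frac[OF imageI[OF s]]] by (simp add: deg algebra_simps)
    qed
    finally show ?thesis .
  qed
qed

lemma frac_mono:
  assumes "x \<in> frac_filtration c" "b \<le> c"
  shows "x \<in> frac_filtration b"
proof -
  obtain d y where "x \<in> carrier K" "y \<in> exact d" "x \<otimes> y \<in> \<pi> ` mpoly_ge m \<epsilon> (c + d)"
    using assms by (auto simp: frac_filtration_def)
  moreover have "\<pi> ` mpoly_ge m \<epsilon> (c + d) \<subseteq> (\<pi> ` mpoly_ge m \<epsilon> (b + d) :: 'a set)"
    using assms(2) by (intro image_mono subsetI) (erule mpoly_ge_mono, simp)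
  ultimately show ?thesis unfolding frac_filtration_def by blast
qed

text \<open>The estimate passes from monomials to polynomials by additivity, and then to fractions
  by the quotient rule \<open>D x = (D (x y) - x D y) / y\<close>.\<close>

lemma derivation_filtered:
  assumes D_closed: "\<And>x. x \<in> carrier K \<Longrightarrow> D x \<in> carrier K"
    and D_add: "\<And>x y. \<lbrakk>x \<in> carrier K; y \<in> carrier K\<rbrakk> \<Longrightarrow> D (x \<oplus> y) = D x \<oplus> D y"
    and D_mult: "\<And>x y. \<lbrakk>x \<in> carrier K; y \<in> carrier K\<rbrakk> \<Longrightarrow> D (x \<otimes> y) = x \<otimes> D y \<oplus> D x \<otimes> y"
    and D_scalar: "\<And>k x. x \<in> carrier K \<Longrightarrow> D (k \<odot>\<^bsub>K\<^esub> x) = k \<odot>\<^bsub>K\<^esub> D x"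
    and D_var: "\<And>j. j < m \<Longrightarrow> D (\<pi> (mvar j)) \<in> frac_filtration (\<epsilon> + c)"
    and x: "x \<in> frac_filtration a"
  shows "D x \<in> frac_filtration (a + c)"
proof -
  have poly: "D (\<pi> p) \<in> frac_filtration (b + c)" if p: "p \<in> mpoly_ge m \<epsilon> b" for p b
  proof -
    have "sum (\<lambda>e. Poly_Mapping.single e (Poly_Mapping.lookup p e)) S \<in> carrier (mpoly_algebra m) \<and>
      D (\<pi> (sum (\<lambda>e. Poly_Mapping.single e (Poly_Mapping.lookup p e)) S)) \<in> frac_filtration (b + c)"
      if "finite S" "S \<subseteq> Poly_Mapping.keys p" for S
      using that
    proof (induction S rule: finite_induct)
      case empty
      have "D \<zero> = D \<zero> \<oplus> D \<zero>" using D_add[of \<zero> \<zero>] by simp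
      then have "D \<zero> = \<zero>" using D_closed[of \<zero>] by simp
      then show ?case using frac_zero by (simp add: mpoly_closed)
    next
      case (insert e S)
      let ?s = "Poly_Mapping.single e (Poly_Mapping.lookup p e)"
      have e: "Poly_Mapping.keys e \<subseteq> {..<m}" "b \<le> \<epsilon> * int (exponent_degree e)"
        using p insert.prems by (auto simp: mpoly_ge_def mpoly_carrier)
      have "D (\<pi> ?s) \<in> frac_filtration (\<epsilon> * int (exponent_degree e) + c)"
        by (rule derivation_monomial[OF D_closed D_mult D_scalar D_var e(1)])
      then have "D (\<pi> ?s) \<in> frac_filtration (b + c)" by (rule frac_mono) (use e(2) in simp)
      moreover have "?s \<in> carrier (mpoly_algebra m)"
        using mpoly_graded_carrier(2)[OF monomial_graded[OF e(1)]] .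
      ultimately show ?case using insert by (simp add: mpoly_closed D_add frac_add)
    qed
    from this[of "Poly_Mapping.keys p"] show ?thesis by (simp add: sum_monomials)
  qed
  obtain d y where y: "x \<in> carrier K" "y \<in> exact d" "x \<otimes> y \<in> \<pi> ` mpoly_ge m \<epsilon> (a + d)"
    using x by (auto simp: frac_filtration_def)
  have yc: "y \<in> carrier K" and y0: "y \<noteq> \<zero>" using y(2) by (auto simp: exact_carrier exact_nonzero)
  have u: "y \<in> Units K" using yc y0 field_Units by auto
  have D: "D x \<in> carrier K" "D y \<in> carrier K" using D_closed y yc by auto
  have "D (x \<otimes> y) \<in> frac_filtration (a + d + c)" using poly y(3) by auto
  moreover have "x \<otimes> D y \<in> frac_filtration (a + (d + c))"
    using exact_image[OF y(2)] poly by (intro frac_mult[OF x]) auto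
  \<comment> \<open>Both terms of the quotient rule have weight \<open>a + d + c\<close>; dividing
    by \<open>y\<close>, of exact weight \<open>d\<close>, leaves \<open>a + c\<close>.\<close>
  ultimately have "D (x \<otimes> y) \<oplus> \<ominus> (x \<otimes> D y) \<in> frac_filtration (a + d + c)"
    by (intro frac_add frac_minus) (simp_all add: add.assoc)
  then have "(D (x \<otimes> y) \<oplus> \<ominus> (x \<otimes> D y)) \<otimes> inv y \<in> frac_filtration (a + d + c + - d)"
    using exact_inv[OF y(2)] by (rule frac_mult)
  moreover have "D (x \<otimes> y) \<oplus> \<ominus> (x \<otimes> D y) = D x \<otimes> y"
    using D y(1) yc by (simp add: D_mult a_comm[of "x \<otimes> D y"] a_assoc r_neg)
  then have "(D (x \<otimes> y) \<oplus> \<ominus> (x \<otimes> D y)) \<otimes> inv y = D x"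
    using D u yc by (simp add: m_assoc)
  ultimately show ?thesis by simp
qed

text \<open>The arguments of the bracket are generalised from generators to arbitrary elements one slot
  at a time, each slot being a derivation.\<close>

lemma bracket_filtered_prefix:
  assumes "i \<le> n" "length us = n" "length cs = n"
    and "\<And>s. s < i \<Longrightarrow> us ! s \<in> frac_filtration (cs ! s)"
    and "\<And>s. \<lbrakk>i \<le> s; s < n\<rbrakk> \<Longrightarrow> cs ! s = \<epsilon> \<and> (\<exists>j<m. us ! s = \<pi> (mvar j))"
  shows "bracket K us \<in> frac_filtration (sum_list cs + 1)"
  using assms
proof (induction i arbitrary: us cs)
  case 0
  then have "\<forall>s<n. \<exists>j<m. us ! s = \<pi> (mvar j)" by auto
  then obtain f where f: "\<And>s. s < n \<Longrightarrow> f s < m \<and> us ! s = \<pi> (mvar (f s))" by metis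
  have us: "us = map (\<lambda>j. \<pi> (mvar j)) (map f [0..<n])"
    using 0 f by (intro nth_equalityI) auto
  have "cs = replicate n \<epsilon>" using 0 by (intro nth_equalityI) auto
  then have "sum_list cs = int n * \<epsilon>" by (simp add: sum_list_replicate)
  moreover have "length (map f [0..<n]) = n" "set (map f [0..<n]) \<subseteq> {..<m}" using f by auto
  ultimately show ?case using bracket_vars[of "map f [0..<n]"] image_frac us by auto
next
  case (Suc i)
  let ?D = "\<lambda>x. bracket K (us[i := x])"
  have i: "i < n" using Suc.prems by simp
  have us: "set us \<subseteq> carrier K"
  proof
    fix u assume "u \<in> set us"
    then obtain s where s: "s < n" "u = us ! s" using Suc.prems(2) by (auto simp: in_set_conv_nth)
    show "u \<in> carrier K"
    proof (cases "s < Suc i")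
      case True
      then show ?thesis using Suc.prems(4)[of s] s frac_carrier by blast
    next
      case False
      then show ?thesis using Suc.prems(5)[of s] s by (auto simp: mpoly_closed)
    qed
  qed
  have upd: "set (us[i := x]) \<subseteq> carrier K" if "x \<in> carrier K" for x
    using us that set_update_subset_insert[of us i x] by blast
  have sum: "sum_list (cs[i := \<epsilon>]) = sum_list cs - cs ! i + \<epsilon>"
  proof -
    have "cs = take i cs @ cs ! i # drop (Suc i) cs" using i Suc.prems(3) by (simp add: id_take_nth_drop)
    then have "sum_list cs = sum_list (take i cs) + (cs ! i + sum_list (drop (Suc i) cs))"
      by (metis sum_list.Cons sum_list_append)
    then show ?thesis using i Suc.prems(3) by (simp add: upd_conv_take_nth_drop)
  qed
  \<comment> \<open>Slot \<open>i\<close> is a derivation whose gain in weight is the total weight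
    of the other slots plus 1. The induction hypothesis, with a variable of weight
    \<open>\<epsilon>\<close> in this slot, supplies the estimate on generators.\<close>
  have "?D (us ! i) \<in> frac_filtration (cs ! i + (sum_list cs - cs ! i + 1))"
  proof (rule derivation_filtered[where D = ?D])
    show "?D x \<in> carrier K" if "x \<in> carrier K" for x
      using upd[OF that] Suc.prems by (intro bracket_closed) auto
    show "?D (x \<oplus> y) = ?D x \<oplus> ?D y" if "x \<in> carrier K" "y \<in> carrier K" for x y
      using bracket_add[OF Suc.prems(2) us i that] .
    show "?D (x \<otimes> y) = x \<otimes> ?D y \<oplus> ?D x \<otimes> y" if "x \<in> carrier K" "y \<in> carrier K" for x y
      using bracket_Leibniz[OF Suc.prems(2) us i that] .
    show "?D (k \<odot>\<^bsub>K\<^esub> x) = k \<odot>\<^bsub>K\<^esub> ?D x" if "x \<in> carrier K" for k x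
      using bracket_smult[OF Suc.prems(2) us i that] .
    show "us ! i \<in> frac_filtration (cs ! i)" using Suc.prems(4)[of i] by simp
    show "?D (\<pi> (mvar j)) \<in> frac_filtration (\<epsilon> + (sum_list cs - cs ! i + 1))" if "j < m" for j
    proof -
      have "?D (\<pi> (mvar j)) \<in> frac_filtration (sum_list (cs[i := \<epsilon>]) + 1)"
      proof (rule Suc.IH)
        fix s
        show "us[i := \<pi> (mvar j)] ! s \<in> frac_filtration (cs[i := \<epsilon>] ! s)" if "s < i"
          using that Suc.prems(4)[of s] by simp
        show "cs[i := \<epsilon>] ! s = \<epsilon> \<and> (\<exists>j'<m. us[i := \<pi> (mvar j)] ! s = \<pi> (mvar j'))"
          if "i \<le> s" "s < n"
          using that Suc.prems(2,3) Suc.prems(5)[of s] \<open>j < m\<close> by (cases "s = i") auto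
      qed (use Suc.prems in auto)
      then show ?thesis by (simp add: sum algebra_simps)
    qed
  qed
  then show ?case by simp
qed

text \<open>Taking \<open>i = n\<close> in \<open>bracket_filtered_prefix\<close> frees every slot,
  which is the bracket inequality of a filtration.\<close>

sublocale nambu_filtration n K frac_filtration
proof
  show "frac_filtration c \<subseteq> carrier K" for c using frac_carrier by blast
  show "k \<odot>\<^bsub>K\<^esub> \<one> \<in> frac_filtration 0" if "k \<noteq> 0" for k
    using image_frac[OF exact_image[OF exact_const[OF that]]] .
  show "bracket K us \<in> frac_filtration (sum_list cs + 1)"
    if "length us = n" "list_all2 (\<lambda>u c. u \<in> frac_filtration c) us cs" for us cs
    using that by (intro bracket_filtered_prefix[of n]) (auto simp: list_all2_conv_all_nth)
qed (use frac_mult frac_inv frac_one in auto)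

end

section \<open>The Weyl field\<close>

context nambu_poisson_algebra
begin

text \<open>Polarisation: expanding the bracket with \<open>x \<oplus> y\<close> in both slots
  leaves only the two mixed terms, whose sum is therefore zero.\<close>

lemma bracket_swap:
  assumes us: "length us = n" "set us \<subseteq> carrier P" and ij: "i < n" "j < n" "i \<noteq> j"
  shows "bracket P (us[i := us ! j, j := us ! i]) = \<ominus> bracket P us"
proof -
  let ?B = "\<lambda>x y. bracket P (us[i := x, j := y])"
  have upd: "set (us[i := x, j := y]) \<subseteq> carrier P" "set (us[i := x]) \<subseteq> carrier P"
    if "x \<in> carrier P" "y \<in> carrier P" for x y
    using that us by (auto dest!: subsetD[OF set_update_subset_insert])
  have closed: "?B x y \<in> carrier P" if "x \<in> carrier P" "y \<in> carrier P" for x y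
    using upd[OF that] us by (intro bracket_closed) auto
  have add2: "?B x (y \<oplus> z) = ?B x y \<oplus> ?B x z"
    if "x \<in> carrier P" "y \<in> carrier P" "z \<in> carrier P" for x y z
    using that us upd ij by (intro bracket_add) auto
  have add1: "?B (x \<oplus> y) z = ?B x z \<oplus> ?B y z"
    if "x \<in> carrier P" "y \<in> carrier P" "z \<in> carrier P" for x y z
  proof -
    \<comment> \<open>Additivity speaks about the outermost update, so the updates at the two
      distinct positions are first exchanged.\<close>
    have "set (us[j := z]) \<subseteq> carrier P"
      using that us by (auto dest!: subsetD[OF set_update_subset_insert])
    then have "bracket P (us[j := z, i := x \<oplus> y])
        = bracket P (us[j := z, i := x]) \<oplus> bracket P (us[j := z, i := y])"
      using that us ij by (intro bracket_add) auto
    then show ?thesis using ij by (simp add: list_update_swap)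
  qed
  have alt: "?B x x = \<zero>" if "x \<in> carrier P" for x
  proof (cases "i < j")
    case True
    then show ?thesis using that us upd ij by (intro bracket_alternating[of _ i j]) auto
  next
    case False
    then show ?thesis using that us upd ij by (intro bracket_alternating[of _ j i]) auto
  qed
  define x where "x = us ! i"
  define y where "y = us ! j"
  have xy: "x \<in> carrier P" "y \<in> carrier P" using us ij by (auto simp: x_def y_def)
  have "?B (x \<oplus> y) (x \<oplus> y) = (?B x x \<oplus> ?B y x) \<oplus> (?B x y \<oplus> ?B y y)"
    using xy by (simp only: add1 add2 a_closed)
  then have "?B y x \<oplus> ?B x y = \<zero>"
    using xy closed by (simp add: alt a_comm)
  then have "?B y x = \<ominus> ?B x y" using closed xy by (simp add: minus_equality)
  then show ?thesis by (simp add: x_def y_def)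
qed

text \<open>Every permutation is a composition of transpositions, each changing the sign. The sign
  itself is left open, as either value serves for a weight estimate.\<close>

lemma bracket_permute:
  assumes "length us = n" "set us \<subseteq> carrier P" "mset vs = mset us"
  shows "bracket P vs = bracket P us \<or> bracket P vs = \<ominus> bracket P us"
proof -
  obtain p where p: "p permutes {..<n}" "permute_list p us = vs"
    using mset_eq_permutation[OF assms(3)] assms(1) by auto
  have "bracket P (permute_list p us) = bracket P us \<or> bracket P (permute_list p us) = \<ominus> bracket P us"
    using finite_lessThan p(1)
  proof (induction p rule: permutes_rev_induct)
    case id
    then show ?case by simp
  next
    case (swap a b p)
    let ?v = "permute_list p us"
    have v: "length ?v = n" "set ?v \<subseteq> carrier P" using assms swap by auto
    have "permute_list (p \<circ> Transposition.transpose a b) us = permute_list (Transposition.transpose a b) ?v"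
      using swap assms by (intro permute_list_compose) (simp add: permutes_swap_id)
    also have "\<dots> = ?v[a := ?v ! b, b := ?v ! a]"
      using swap v by (intro nth_equalityI)
        (auto simp: permute_list_nth permutes_swap_id nth_list_update Transposition.transpose_def)
    finally have "bracket P (permute_list (p \<circ> Transposition.transpose a b) us) = \<ominus> bracket P ?v"
      using bracket_swap[OF v] swap by simp
    then show ?case using swap.IH bracket_closed[OF assms(1,2)] by (auto simp: o_def)
  qed
  then show ?thesis using p by simp
qed

end

text \<open>The variables present \<open>K\<close> with trivial kernel. The bracket of any
  \<open>n\<close> of them is 0, 1 or -1, a constant of weight 0.\<close>

lemma Weyl_presentation:
  fixes W :: "('k::field, 'k ratfun) nambu" and K :: "('k, 'a) nambu"
  assumes n: "n \<ge> 1" and W: "is_N_Weyl n W" and K: "nambu_poisson_field n K"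
    and \<phi>: "\<phi> \<in> nambu_hom n W K" "bij_betw \<phi> (carrier W) (carrier K)"
  shows "graded_presentation n K n (- 1) (\<lambda>p. \<phi> (Fract p 1))"
proof -
  interpret K: nambu_poisson_field n K by (rule K)
  interpret W: nambu_poisson_field n W using W by (simp add: is_N_Weyl_def)
  have tr: "module.truncate W = ratfun_algebra n" and br: "bracket W (map rvar [0..<n]) = 1"
    using W by (auto simp: is_N_Weyl_def)
  have ops: "carrier W = carrier (ratfun_algebra n)" "monoid.mult W = (*)" "one W = 1" "zero W = 0"
    "add W = (+)" "module.smult W = (\<lambda>c x. Fract (mconst c) 1 * x)"
    using tr by (auto simp: module.truncate_def ratfun_algebra_def)
  interpret \<phi>: ring_hom_ring W K \<phi>
    using \<phi>(1) by unfold_locales (auto simp: nambu_hom_def)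
  have car: "Fract p 1 \<in> carrier W" if "p \<in> carrier (mpoly_algebra n)" for p :: "'k mpoly"
    unfolding ops using that mpoly_closed(2)[of n, where 'k = 'k]
    by (simp add: ratfun_algebra_def) (metis zero_neq_one)
  have inj: "p = q" if "\<phi> (Fract p 1) = \<phi> (Fract q 1)"
    "p \<in> carrier (mpoly_algebra n)" "q \<in> carrier (mpoly_algebra n)" for p q :: "'k mpoly"
  proof -
    have "Fract p 1 = Fract q 1"
      using that \<phi>(2) car by (auto simp: bij_betw_def dest: inj_onD)
    then show ?thesis by (simp add: eq_fract)
  qed
  have zero: "\<phi> (Fract 0 1) = \<zero>\<^bsub>K\<^esub>"
    using \<phi>.hom_zero by (simp add: ops Zero_fract_def)
  have one: "\<phi> (Fract 1 1) = \<one>\<^bsub>K\<^esub>"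
    using \<phi>.hom_one by (simp add: ops One_fract_def)
  show ?thesis
  proof
    show "(\<lambda>p. \<phi> (Fract p 1)) \<in> ring_hom (mpoly_algebra n) K"
    proof (rule ring_hom_memI)
      fix p q :: "'k mpoly"
      assume p: "p \<in> carrier (mpoly_algebra n)"
      then show "\<phi> (Fract p 1) \<in> carrier K" using car by simp
      assume q: "q \<in> carrier (mpoly_algebra n)"
      show "\<phi> (Fract (p \<otimes>\<^bsub>mpoly_algebra n\<^esub> q) 1) = \<phi> (Fract p 1) \<otimes>\<^bsub>K\<^esub> \<phi> (Fract q 1)"
        using \<phi>.hom_mult[OF car[OF p] car[OF q]] by (simp add: ops mpoly_ops)
      show "\<phi> (Fract (p \<oplus>\<^bsub>mpoly_algebra n\<^esub> q) 1) = \<phi> (Fract p 1) \<oplus>\<^bsub>K\<^esub> \<phi> (Fract q 1)"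
        using \<phi>.hom_add[OF car[OF p] car[OF q]] by (simp add: ops mpoly_ops)
    qed (simp add: mpoly_ops one)
    show "\<phi> (Fract (mconst k) 1) = k \<odot>\<^bsub>K\<^esub> \<one>\<^bsub>K\<^esub>" for k
    proof -
      have "\<phi> (k \<odot>\<^bsub>W\<^esub> \<one>\<^bsub>W\<^esub>) = k \<odot>\<^bsub>K\<^esub> \<phi> \<one>\<^bsub>W\<^esub>" using \<phi>(1) by (simp add: nambu_hom_def)
      then show ?thesis by (simp add: ops(6)) (simp add: ops)
    qed
    show "\<exists>p\<in>carrier (mpoly_algebra n). \<exists>q\<in>carrier (mpoly_algebra n).
        \<phi> (Fract q 1) \<noteq> \<zero>\<^bsub>K\<^esub> \<and> x \<otimes>\<^bsub>K\<^esub> \<phi> (Fract q 1) = \<phi> (Fract p 1)"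
      if x: "x \<in> carrier K" for x
    proof -
      obtain w where w: "w \<in> carrier W" "x = \<phi> w" using x \<phi>(2) by (auto simp: bij_betw_def)
      then obtain p q where pq: "w = Fract p q" "p \<in> carrier (mpoly_algebra n)"
          "q \<in> carrier (mpoly_algebra n)" "q \<noteq> 0"
        by (auto simp: ops ratfun_algebra_def)
      have "x \<otimes>\<^bsub>K\<^esub> \<phi> (Fract q 1) = \<phi> (w * Fract q 1)"
        using \<phi>.hom_mult[OF w(1) car[OF pq(3)]] w(2) by (simp add: ops)
      also have "w * Fract q 1 = Fract p 1" using pq by (simp add: eq_fract)
      finally show ?thesis using pq inj[of q 0] zero by (metis mpoly_closed(1))
    qed
    show "\<phi> (Fract g 1) = \<zero>\<^bsub>K\<^esub>"
      if "g \<in> mpoly_homog n (- 1) d" "h \<in> mpoly_ge n (- 1) (d + 1)" "\<phi> (Fract g 1) = \<phi> (Fract h 1)" for g h d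
    proof -
      \<comment> \<open>With a trivial kernel the two polynomials coincide, and no monomial has
        weight both \<open>d\<close> and at least \<open>d + 1\<close>.\<close>
      have "g = h" using that by (intro inj) (auto simp: mpoly_graded_carrier)
      then have "Poly_Mapping.keys g = {}" using that by (fastforce simp: mpoly_homog_def mpoly_ge_def)
      then show ?thesis using zero by simp
    qed
    show "\<exists>p\<in>mpoly_ge n (- 1) (int n * - 1 + 1).
        bracket K (map (\<lambda>j. \<phi> (Fract (mvar j) 1)) js) = \<phi> (Fract p 1)"
      if js: "length js = n" "set js \<subseteq> {..<n}" for js
    proof -
      let ?f = "\<lambda>j. \<phi> (Fract (mvar j) 1)"
      have fc: "?f j \<in> carrier K" if "j < n" for j using car that by (simp add: mpoly_closed)
      have const: "\<phi> (Fract (mconst k) 1) = k \<odot>\<^bsub>K\<^esub> \<one>\<^bsub>K\<^esub>" for k by fact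
      \<comment> \<open>With weight -1 for each variable the required bound is
        \<open>1 - n \<le> 0\<close>.\<close>
      have ge: "mconst k \<in> mpoly_ge n (- 1) (int n * - 1 + 1)" for k :: 'k
        by (rule mpoly_ge_mono[OF mpoly_homog_ge[OF mpoly_homog_const]]) (use n in simp)
      have vol: "bracket K (map ?f [0..<n]) = \<one>\<^bsub>K\<^esub>"
      proof -
        have "set (map rvar [0..<n]) \<subseteq> carrier W"
          using car by (auto simp: rvar_def mpoly_closed)
        then have "bracket K (map \<phi> (map rvar [0..<n])) = \<phi> (bracket W (map rvar [0..<n]))"
          using \<phi>(1) by (simp add: nambu_hom_def del: map_map)
        then show ?thesis using \<phi>.hom_one by (simp add: br ops rvar_def comp_def)
      qed
      have "\<exists>k. bracket K (map ?f js) = k \<odot>\<^bsub>K\<^esub> \<one>\<^bsub>K\<^esub>"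
      proof (cases "distinct js")
        case True
        \<comment> \<open>Distinct indices must exhaust \<open>{..<n}\<close>, so \<open>js\<close>
          is a permutation of \<open>[0..<n]\<close>.\<close>
        then have "card (set js) = card {..<n}" using js(1) by (simp add: distinct_card)
        then have "set js = set [0..<n]"
          using card_subset_eq[OF finite_lessThan js(2)] by (simp add: atLeast0LessThan)
        then have "mset js = mset [0..<n]"
          using set_eq_iff_mset_eq_distinct[OF True distinct_upt] by blast
        then have "mset (map ?f js) = mset (map ?f [0..<n])" by simp
        then have "bracket K (map ?f js) = \<one>\<^bsub>K\<^esub> \<or> bracket K (map ?f js) = \<ominus>\<^bsub>K\<^esub> \<one>\<^bsub>K\<^esub>"
          using K.bracket_permute[of "map ?f [0..<n]" "map ?f js"] vol fc
          by (simp add: image_subset_iff del: mset_map)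
        moreover have "\<ominus>\<^bsub>K\<^esub> \<one>\<^bsub>K\<^esub> = (- 1) \<odot>\<^bsub>K\<^esub> \<one>\<^bsub>K\<^esub>"
          by (simp add: K.scalar_minus_one)
        ultimately show ?thesis using K.scalar_one[of "\<one>\<^bsub>K\<^esub>"] by (metis K.one_closed)
      next
        case False
        then obtain a b where "a < length js" "b < length js" "a \<noteq> b" "js ! a = js ! b"
          by (auto simp: distinct_conv_nth)
        then obtain a b where ab: "a < b" "b < n" "js ! a = js ! b"
          using js(1) by (metis linorder_neqE_nat)
        have "bracket K (map ?f js) = \<zero>\<^bsub>K\<^esub>"
          using ab js fc by (intro K.bracket_alternating[of _ a b]) auto
        then show ?thesis using K.scalar_zero[of "\<one>\<^bsub>K\<^esub>"] by (metis K.one_closed)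
      qed
      then show ?thesis using const ge by metis
    qed
  qed
qed

section \<open>The field of a potential\<close>

text \<open>A description by coefficients, free of the truncated subtraction of exponents in the
  definition.\<close>

lemma lookup_partial_deriv:
  fixes p :: "'k::comm_ring_1 mpoly"
  shows "Poly_Mapping.lookup (partial_deriv i p) e
    = of_nat (Poly_Mapping.lookup e i + 1) * Poly_Mapping.lookup p (e + Poly_Mapping.single i 1)"
proof -
  let ?f = "e + Poly_Mapping.single i 1"
  \<comment> \<open>Truncated subtraction can be undone only where variable \<open>i\<close> occurs;
    the other monomials enter with coefficient 0.\<close>
  have eq: "f - Poly_Mapping.single i 1 = e \<longleftrightarrow> f = ?f" if "Poly_Mapping.lookup f i \<noteq> 0" for f
  proof
    assume "f - Poly_Mapping.single i 1 = e"
    then have "\<And>j. Poly_Mapping.lookup e j = Poly_Mapping.lookup f j - (1 when i = j)"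
      by (auto simp: lookup_minus lookup_single)
    then show "f = ?f" using that
      by (intro poly_mapping_eqI) (auto simp: lookup_add lookup_single when_def)
  qed simp
  have "Poly_Mapping.lookup (partial_deriv i p) e = (\<Sum>f\<in>Poly_Mapping.keys p.
      of_nat (Poly_Mapping.lookup f i) * Poly_Mapping.lookup p f when f - Poly_Mapping.single i 1 = e)"
    by (simp add: partial_deriv_def lookup_sum lookup_single)
  also have "\<dots> = (\<Sum>f\<in>Poly_Mapping.keys p.
      of_nat (Poly_Mapping.lookup f i) * Poly_Mapping.lookup p f when f = ?f)"
  proof (rule sum.cong)
    fix f
    show "(of_nat (Poly_Mapping.lookup f i) * Poly_Mapping.lookup p f when f - Poly_Mapping.single i 1 = e)
      = (of_nat (Poly_Mapping.lookup f i) * Poly_Mapping.lookup p f when f = ?f)"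
      using eq[of f] by (cases "Poly_Mapping.lookup f i = 0") (simp_all add: when_def)
  qed simp
  also have "\<dots> = of_nat (Poly_Mapping.lookup ?f i) * Poly_Mapping.lookup p ?f"
    by (simp add: when_def in_keys_iff)
  finally show ?thesis by (simp add: lookup_add)
qed

lemma partial_deriv_add: "partial_deriv i (p + q) = partial_deriv i p + partial_deriv i q"
  by (rule poly_mapping_eqI) (simp add: lookup_partial_deriv lookup_add distrib_left)

lemma partial_deriv_sum: "partial_deriv i (\<Sum>x\<in>X. f x) = (\<Sum>x\<in>X. partial_deriv i (f x))"
proof (induction X rule: infinite_finite_induct)
  case (insert x X)
  then show ?case by (simp add: partial_deriv_add)
qed (simp_all add: partial_deriv_def)

lemma partial_deriv_single:
  "partial_deriv i (Poly_Mapping.single e c)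
    = Poly_Mapping.single (e - Poly_Mapping.single i 1) (of_nat (Poly_Mapping.lookup e i) * c)"
  by (cases "c = 0") (simp_all add: partial_deriv_def)

lemma partial_deriv_single_mult:
  fixes c d :: "'k::comm_ring_1"
  shows "partial_deriv i (Poly_Mapping.single e c * Poly_Mapping.single f d)
    = partial_deriv i (Poly_Mapping.single e c) * Poly_Mapping.single f d
      + Poly_Mapping.single e c * partial_deriv i (Poly_Mapping.single f d)"
proof -
  have shift: "a - Poly_Mapping.single i 1 + b = a + b - Poly_Mapping.single i 1"
    if "Poly_Mapping.lookup a i \<noteq> 0" for a b :: "nat \<Rightarrow>\<^sub>0 nat"
    using that by (intro poly_mapping_eqI) (auto simp: lookup_add lookup_minus lookup_single when_def)
  have "Poly_Mapping.single (e - Poly_Mapping.single i 1) (of_nat (Poly_Mapping.lookup e i) * c)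
      * Poly_Mapping.single f d
    = Poly_Mapping.single (e + f - Poly_Mapping.single i 1) (of_nat (Poly_Mapping.lookup e i) * (c * d))"
    using shift[of e f] by (cases "Poly_Mapping.lookup e i = 0") (simp_all add: mult_single mult.assoc)
  moreover have "Poly_Mapping.single e c
      * Poly_Mapping.single (f - Poly_Mapping.single i 1) (of_nat (Poly_Mapping.lookup f i) * d)
    = Poly_Mapping.single (e + f - Poly_Mapping.single i 1) (of_nat (Poly_Mapping.lookup f i) * (c * d))"
    using shift[of f e]
    by (cases "Poly_Mapping.lookup f i = 0") (simp_all add: mult_single mult.left_commute add.commute)
  ultimately show ?thesis
    by (simp add: mult_single partial_deriv_single lookup_add distrib_right flip: single_add)
qed

lemma partial_deriv_mult:
  fixes p q :: "'k::comm_ring_1 mpoly"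
  shows "partial_deriv i (p * q) = partial_deriv i p * q + p * partial_deriv i q"
proof -
  let ?s = "\<lambda>p e. Poly_Mapping.single e (Poly_Mapping.lookup p e) :: 'k mpoly"
  let ?P = "Poly_Mapping.keys p" and ?Q = "Poly_Mapping.keys q"
  have "partial_deriv i ((\<Sum>e\<in>?P. ?s p e) * (\<Sum>f\<in>?Q. ?s q f))
    = partial_deriv i (\<Sum>e\<in>?P. ?s p e) * (\<Sum>f\<in>?Q. ?s q f)
      + (\<Sum>e\<in>?P. ?s p e) * partial_deriv i (\<Sum>f\<in>?Q. ?s q f)"
    by (simp add: sum_product partial_deriv_sum partial_deriv_single_mult sum.distrib)
  then show ?thesis by (simp add: sum_monomials)
qed

text \<open>Every monomial of the derivative, multiplied by variable \<open>i\<close>, is a monomial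
  of \<open>p\<close>.\<close>

lemma partial_deriv_ge:
  assumes "p \<in> mpoly_ge m 1 d"
  shows "partial_deriv i p \<in> mpoly_ge m 1 (d - 1)"
proof -
  have "Poly_Mapping.keys e \<subseteq> {..<m} \<and> d - 1 \<le> int (exponent_degree e)"
    if "e \<in> Poly_Mapping.keys (partial_deriv i p)" for e
  proof -
    let ?e = "e + Poly_Mapping.single i 1"
    have "?e \<in> Poly_Mapping.keys p" using that by (auto simp: in_keys_iff lookup_partial_deriv)
    then have "Poly_Mapping.keys ?e \<subseteq> {..<m}" "d \<le> int (exponent_degree ?e)"
      using assms by (auto simp: mpoly_ge_def mpoly_carrier)
    moreover have "Poly_Mapping.keys e \<subseteq> Poly_Mapping.keys ?e" by (auto simp: in_keys_iff lookup_add)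
    ultimately show ?thesis by (auto simp: exponent_degree_add)
  qed
  then show ?thesis by (auto simp: mpoly_ge_def mpoly_carrier)
qed

lemma mpoly_ge_zero: "mpoly_ge m 1 0 = carrier (mpoly_algebra m)"
  by (auto simp: mpoly_ge_def)

lemma partial_deriv_closed:
  "p \<in> carrier (mpoly_algebra m) \<Longrightarrow> partial_deriv i p \<in> carrier (mpoly_algebra m)"
  using partial_deriv_ge[of p m 0 i] mpoly_graded_carrier by (auto simp: mpoly_ge_zero)

section \<open>Determinants with polynomial entries\<close>

text \<open>Each term of the permutation expansion contains exactly one entry of row
  \<open>k\<close>.\<close>

lemma det_linear_row:
  fixes r s :: "nat \<Rightarrow> 'b::comm_ring_1"
  assumes "k < N"
  shows "det (mat N N (\<lambda>(i, j). if i = k then a * r j + s j else c i j))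
    = a * det (mat N N (\<lambda>(i, j). if i = k then r j else c i j))
      + det (mat N N (\<lambda>(i, j). if i = k then s j else c i j))"
proof -
  have expand: "det (mat N N (\<lambda>(i, j). if i = k then t j else c i j))
    = (\<Sum>p | p permutes {0..<N}. signof p * (t (p k) * (\<Prod>i\<in>{0..<N} - {k}. c i (p i))))"
    for t :: "nat \<Rightarrow> 'b"
  proof -
    have "(\<Prod>i = 0..<N. mat N N (\<lambda>(i, j). if i = k then t j else c i j) $$ (i, p i))
      = t (p k) * (\<Prod>i\<in>{0..<N} - {k}. c i (p i))" if p: "p permutes {0..<N}" for p
    proof -
      have "p i < N" if "i < N" for i using permutes_in_image[OF p, of i] that by auto
      then show ?thesis using assms by (subst prod.remove[of _ k]) (auto intro!: prod.cong)
    qed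
    then show ?thesis by (subst det_def'[of _ N]) (auto intro!: sum.cong)
  qed
  show ?thesis
    unfolding expand by (simp add: algebra_simps sum.distrib sum_distrib_left)
qed

text \<open>Each term of the permutation expansion has one factor from the last row, which carries
  the weight \<open>d\<close>; its other factors are polynomials, of weight at least 0. The last row
  is meant for the gradient of \<open>\<Omega>\<close>.\<close>

lemma det_ge:
  assumes "\<And>i j. \<lbrakk>i < N; j \<le> N\<rbrakk> \<Longrightarrow> f (i, j) \<in> carrier (mpoly_algebra m)"
    and "\<And>j. j \<le> N \<Longrightarrow> f (N, j) \<in> mpoly_ge m 1 d"
  shows "det (mat (N + 1) (N + 1) f) \<in> mpoly_ge m 1 d"
proof -
  have zero: "0 \<in> mpoly_ge m 1 d" by (simp add: mpoly_ge_def mpoly_closed)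
  have sum: "sum g X \<in> mpoly_ge m 1 d" if "\<And>x. x \<in> X \<Longrightarrow> g x \<in> mpoly_ge m 1 d" for g and X :: "(nat \<Rightarrow> nat) set"
    using that by (induction X rule: infinite_finite_induct) (auto simp: zero mpoly_ge_add)
  have "signof p * (\<Prod>i = 0..<N + 1. mat (N + 1) (N + 1) f $$ (i, p i)) \<in> mpoly_ge m 1 d"
    if p: "p permutes {0..<N + 1}" for p
  proof -
    have le: "p i \<le> N" if "i \<le> N" for i using permutes_in_image[OF p, of i] that by auto
    have "(\<Prod>i = 0..<k. f (i, p i)) \<in> mpoly_ge m 1 0" if "k \<le> N" for k
      using that
    proof (induction k)
      case 0
      then show ?case by (simp add: mpoly_ge_zero mpoly_closed)
    next
      case (Suc k)
      then show ?case using assms(1)[of k "p k"] le[of k] by (simp add: mpoly_ge_zero mpoly_closed)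
    qed
    from mpoly_ge_mult[OF this[of N] assms(2)[OF le[of N]]]
    have "(\<Prod>i = 0..<N + 1. f (i, p i)) \<in> mpoly_ge m 1 d" by simp
    moreover have "(\<Prod>i = 0..<N + 1. mat (N + 1) (N + 1) f $$ (i, p i)) = (\<Prod>i = 0..<N + 1. f (i, p i))"
      using le by (intro prod.cong) (auto simp: less_Suc_eq_le)
    ultimately have prod: "(\<Prod>i = 0..<N + 1. mat (N + 1) (N + 1) f $$ (i, p i)) \<in> mpoly_ge m 1 d" by simp
    have "signof p \<in> mpoly_ge m 1 0"
      by (auto simp: sign_def mpoly_ge_zero mpoly_closed)
    from mpoly_ge_mult[OF this prod] show ?thesis by simp
  qed
  then show ?thesis by (subst det_def'[of _ "N + 1"]) (auto intro!: sum)
qed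

section \<open>The Jacobian bracket and congruence modulo \<open>\<Omega>\<close>\<close>

lemma A_pot_ops:
  "carrier (A_pot n \<Omega>) = carrier (mpoly_algebra (n + 1))" "monoid.mult (A_pot n \<Omega>) = (*)"
  "one (A_pot n \<Omega>) = 1" "zero (A_pot n \<Omega>) = 0" "add (A_pot n \<Omega>) = (+)"
  "module.smult (A_pot n \<Omega>) = (\<lambda>c p. mconst c * p)"
  "bracket (A_pot n \<Omega>) us
    = det (mat (n + 1) (n + 1) (\<lambda>(i, j). partial_deriv j ((us @ [\<Omega>]) ! i)))"
  by (simp_all add: A_pot_def module.extend_def nambu.fields_def mpoly_algebra_def)

lemma A_pot_cring: "cring (A_pot n \<Omega>)"
proof (rule cringI)
  show "abelian_group (A_pot n \<Omega>)"
  proof (rule abelian_groupI)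
    show "\<exists>y\<in>carrier (A_pot n \<Omega>). y \<oplus>\<^bsub>A_pot n \<Omega>\<^esub> x = \<zero>\<^bsub>A_pot n \<Omega>\<^esub>" if "x \<in> carrier (A_pot n \<Omega>)" for x
      using that by (intro bexI[of _ "- x"]) (auto simp: A_pot_ops mpoly_closed)
  qed (auto simp: A_pot_ops mpoly_closed)
  show "comm_monoid (A_pot n \<Omega>)"
    by (rule comm_monoidI) (auto simp: A_pot_ops mpoly_closed)
qed (auto simp: A_pot_ops distrib_right)

lemma A_pot_bracket_ge:
  assumes "length us = n" "set us \<subseteq> carrier (mpoly_algebra (n + 1))"
    and "\<Omega> \<in> mpoly_ge (n + 1) 1 d"
  shows "bracket (A_pot n \<Omega>) us \<in> mpoly_ge (n + 1) 1 (d - 1)"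
  unfolding A_pot_ops(7) using assms
  by (intro det_ge) (auto simp: nth_append partial_deriv_ge intro!: partial_deriv_closed)

lemma A_pot_bracket_closed:
  assumes "length us = n" "set us \<subseteq> carrier (mpoly_algebra (n + 1))" "\<Omega> \<in> carrier (mpoly_algebra (n + 1))"
  shows "bracket (A_pot n \<Omega>) us \<in> carrier (mpoly_algebra (n + 1))"
  using mpoly_graded_carrier(1)[OF A_pot_bracket_ge[OF assms(1,2), of \<Omega> 0]] assms(3)
  by (simp add: mpoly_ge_zero)

text \<open>By the product rule the gradient of \<open>h * \<Omega> + v\<close> is
  \<open>\<Omega>\<close> times that of \<open>h\<close>, plus \<open>h\<close> times that of
  \<open>\<Omega>\<close>, plus that of \<open>v\<close>. The middle term contributes nothing,
  because the gradient of \<open>\<Omega>\<close> is already the last row.\<close>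

lemma A_pot_bracket_shift:
  assumes "length us = n" "k < n"
  shows "bracket (A_pot n \<Omega>) (us[k := h * \<Omega> + v])
    = bracket (A_pot n \<Omega>) (us[k := h]) * \<Omega> + bracket (A_pot n \<Omega>) (us[k := v])"
proof -
  let ?c = "\<lambda>i j. partial_deriv j ((us @ [\<Omega>]) ! i)"
  let ?M = "\<lambda>r. mat (n + 1) (n + 1) (\<lambda>(i, j). if i = k then r j else ?c i j)"
  have row: "bracket (A_pot n \<Omega>) (us[k := x]) = det (?M (\<lambda>j. partial_deriv j x))" for x
    unfolding A_pot_ops(7) using assms
    by (intro arg_cong[where f = det] eq_matI) (auto simp: nth_append nth_list_update)
  have "det (?M (\<lambda>j. partial_deriv j (h * \<Omega> + v)))
    = det (?M (\<lambda>j. \<Omega> * partial_deriv j h + (h * partial_deriv j \<Omega> + partial_deriv j v)))"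
    by (intro arg_cong[where f = det] eq_matI) (auto simp: partial_deriv_add partial_deriv_mult algebra_simps)
  also have "\<dots> = \<Omega> * det (?M (\<lambda>j. partial_deriv j h))
      + (h * det (?M (\<lambda>j. partial_deriv j \<Omega>)) + det (?M (\<lambda>j. partial_deriv j v)))"
    using assms(2) by (simp add: det_linear_row)
  also have "det (?M (\<lambda>j. partial_deriv j \<Omega>)) = 0"
    using assms by (intro det_identical_rows[of _ "n + 1" k n]) (auto intro!: eq_vecI simp: nth_append)
  finally show ?thesis
    unfolding row by (simp only: mult_zero_right add_0 mult.commute[of \<Omega>])
qed

text \<open>The arguments are replaced one at a time, \<open>take k us @ drop k vs\<close> being the
  list after \<open>k\<close> replacements; each costs a multiple of \<open>\<Omega>\<close>. Hence
  the bracket descends to the quotient.\<close>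

lemma A_pot_bracket_cong:
  assumes "length us = n" "length vs = n" "\<Omega> \<in> carrier (mpoly_algebra (n + 1))"
    and "set vs \<subseteq> carrier (mpoly_algebra (n + 1))"
    and "\<And>i. i < n \<Longrightarrow> \<exists>h\<in>carrier (mpoly_algebra (n + 1)). us ! i = h * \<Omega> + vs ! i"
  shows "\<exists>h\<in>carrier (mpoly_algebra (n + 1)).
    bracket (A_pot n \<Omega>) us = h * \<Omega> + bracket (A_pot n \<Omega>) vs"
proof -
  let ?C = "carrier (mpoly_algebra (n + 1)) :: 'a mpoly set"
  have us: "set us \<subseteq> ?C"
    using assms by (fastforce simp: in_set_conv_nth mpoly_closed)
  have "\<exists>h\<in>?C. bracket (A_pot n \<Omega>) (take k us @ drop k vs) = h * \<Omega> + bracket (A_pot n \<Omega>) vs"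
    if "k \<le> n" for k
    using that
  proof (induction k)
    case 0
    then show ?case by (intro bexI[of _ 0]) (simp_all add: mpoly_closed)
  next
    case (Suc k)
    let ?w = "take k us @ drop k vs"
    obtain h where h: "h \<in> ?C" "bracket (A_pot n \<Omega>) ?w = h * \<Omega> + bracket (A_pot n \<Omega>) vs"
      using Suc by auto
    obtain g where g: "g \<in> ?C" "us ! k = g * \<Omega> + vs ! k" using assms(5)[of k] Suc.prems by auto
    have w: "set ?w \<subseteq> ?C" using us assms(4) set_take_subset[of k us] set_drop_subset[of k vs] by auto
    have eq: "take (Suc k) us @ drop (Suc k) vs = ?w[k := g * \<Omega> + vs ! k]" "?w[k := vs ! k] = ?w"
      using Suc.prems assms(1,2) g by (auto intro!: nth_equalityI simp: nth_append nth_list_update less_Suc_eq)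
    have "bracket (A_pot n \<Omega>) (take (Suc k) us @ drop (Suc k) vs)
      = bracket (A_pot n \<Omega>) (?w[k := g]) * \<Omega> + (h * \<Omega> + bracket (A_pot n \<Omega>) vs)"
      unfolding eq using A_pot_bracket_shift[of ?w n k \<Omega> g "vs ! k"] Suc.prems assms(1,2) h eq(2) by simp
    moreover have "bracket (A_pot n \<Omega>) (?w[k := g]) \<in> ?C"
      using w g Suc.prems assms by (intro A_pot_bracket_closed) (auto dest!: subsetD[OF set_update_subset_insert])
    ultimately have "bracket (A_pot n \<Omega>) (take (Suc k) us @ drop (Suc k) vs)
      = (bracket (A_pot n \<Omega>) (?w[k := g]) + h) * \<Omega> + bracket (A_pot n \<Omega>) vs"
      "bracket (A_pot n \<Omega>) (?w[k := g]) + h \<in> ?C"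
      using h(1) mpoly_closed(5) by (simp only: distrib_right add.assoc, blast)
    then show ?case by blast
  qed
  from this[of n] show ?thesis using assms(1,2) by simp
qed

section \<open>The quotient by the principal ideal of \<open>\<Omega>\<close>\<close>

lemma A_pot_coset:
  "X +>\<^bsub>A_pot n \<Omega>\<^esub> p = (\<lambda>x. x + p) ` X"
  by (auto simp: a_r_coset_def r_coset_def A_pot_ops)

lemma A_pot_principal:
  "PIdl\<^bsub>A_pot n \<Omega>\<^esub> \<Omega> = {h * \<Omega> | h. h \<in> carrier (mpoly_algebra (n + 1))}"
  by (simp add: cgenideal_def A_pot_ops)

definition pot_coset :: "nat \<Rightarrow> 'k::field mpoly \<Rightarrow> 'k mpoly \<Rightarrow> 'k mpoly set" where
  "pot_coset n \<Omega> p = (PIdl\<^bsub>A_pot n \<Omega>\<^esub> \<Omega>) +>\<^bsub>A_pot n \<Omega>\<^esub> p"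

lemma mem_pot_coset:
  "q \<in> pot_coset n \<Omega> p \<longleftrightarrow> (\<exists>h\<in>carrier (mpoly_algebra (n + 1)). q = h * \<Omega> + p)"
  by (auto simp: pot_coset_def A_pot_coset A_pot_principal)

lemma pot_coset_eq:
  assumes "q \<in> pot_coset n \<Omega> p"
  shows "pot_coset n \<Omega> q = pot_coset n \<Omega> p"
proof -
  obtain h where h: "h \<in> carrier (mpoly_algebra (n + 1))" "q = h * \<Omega> + p"
    using assms by (auto simp: mem_pot_coset)
  have "x \<in> pot_coset n \<Omega> q \<longleftrightarrow> x \<in> pot_coset n \<Omega> p" for x
  proof
    assume "x \<in> pot_coset n \<Omega> q"
    then obtain g where "g \<in> carrier (mpoly_algebra (n + 1))" "x = g * \<Omega> + q" by (auto simp: mem_pot_coset)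
    then show "x \<in> pot_coset n \<Omega> p" using h
      by (auto simp: mem_pot_coset algebra_simps mpoly_closed intro!: bexI[of _ "g + h"])
  next
    assume "x \<in> pot_coset n \<Omega> p"
    then obtain g where "g \<in> carrier (mpoly_algebra (n + 1))" "x = g * \<Omega> + p" by (auto simp: mem_pot_coset)
    then show "x \<in> pot_coset n \<Omega> q" using h
      by (auto simp: mem_pot_coset algebra_simps mpoly_closed intro!: bexI[of _ "g - h"])
  qed
  then show ?thesis by blast
qed

lemma pot_coset_self: "p \<in> pot_coset n \<Omega> p"
  unfolding mem_pot_coset by (intro bexI[of _ 0]) (simp_all add: mpoly_closed)

lemma P_pot_ops:
  "carrier (P_pot n \<Omega>) = pot_coset n \<Omega> ` carrier (mpoly_algebra (n + 1))"
  "zero (P_pot n \<Omega>) = pot_coset n \<Omega> 0"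
  "module.smult (P_pot n \<Omega>) = (\<lambda>c X. \<Union>x\<in>X. pot_coset n \<Omega> (mconst c * x))"
  "bracket (P_pot n \<Omega>) = (\<lambda>Xs. \<Union>us\<in>{us. list_all2 (\<in>) us Xs}. pot_coset n \<Omega> (bracket (A_pot n \<Omega>) us))"
  by (auto simp: P_pot_def quotient_nambu_def quotient_algebra_def module.extend_def nambu.fields_def
      ring.extend_def module.fields_def FactRing_def A_RCOSETS_def' pot_coset_def A_pot_ops
      A_pot_coset A_pot_principal)

lemma pot_coset_ring_hom:
  assumes "\<Omega> \<in> carrier (mpoly_algebra (n + 1))"
  shows "pot_coset n \<Omega> \<in> ring_hom (mpoly_algebra (n + 1)) (P_pot n \<Omega>)"
proof -
  interpret A: cring "A_pot n \<Omega>" by (rule A_pot_cring)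
  interpret I: ideal "PIdl\<^bsub>A_pot n \<Omega>\<^esub> \<Omega>" "A_pot n \<Omega>"
    using assms by (intro A.cgenideal_ideal) (simp add: A_pot_ops)
  have "pot_coset n \<Omega> \<in> ring_hom (A_pot n \<Omega>) (A_pot n \<Omega> Quot (PIdl\<^bsub>A_pot n \<Omega>\<^esub> \<Omega>))"
    unfolding pot_coset_def by (rule I.rcos_ring_hom)
  then show ?thesis
    by (simp add: ring_hom_def P_pot_def quotient_nambu_def quotient_algebra_def module.extend_def
        nambu.fields_def ring.extend_def module.fields_def FactRing_def A_pot_ops mpoly_ops)
qed

text \<open>All lists of representatives yield the same coset by \<open>A_pot_bracket_cong\<close>,
  so the union defining the quotient bracket is a single coset.\<close>

lemma P_pot_bracket:
  assumes "length vs = n" "set vs \<subseteq> carrier (mpoly_algebra (n + 1))" "\<Omega> \<in> carrier (mpoly_algebra (n + 1))"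
  shows "bracket (P_pot n \<Omega>) (map (pot_coset n \<Omega>) vs) = pot_coset n \<Omega> (bracket (A_pot n \<Omega>) vs)"
proof -
  let ?U = "{us. list_all2 (\<in>) us (map (pot_coset n \<Omega>) vs)}"
  have "pot_coset n \<Omega> (bracket (A_pot n \<Omega>) us) = pot_coset n \<Omega> (bracket (A_pot n \<Omega>) vs)"
    if "us \<in> ?U" for us
    using that assms A_pot_bracket_cong[of us n vs \<Omega>]
    by (intro pot_coset_eq) (auto simp: mem_pot_coset list_all2_conv_all_nth)
  moreover have "vs \<in> ?U" by (simp add: list_all2_conv_all_nth pot_coset_self)
  ultimately show ?thesis unfolding P_pot_ops(4) by blast
qed

lemma P_pot_smult:
  "module.smult (P_pot n \<Omega>) c (pot_coset n \<Omega> p) = pot_coset n \<Omega> (mconst c * p)"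
proof -
  have "pot_coset n \<Omega> (mconst c * q) = pot_coset n \<Omega> (mconst c * p)" if q: "q \<in> pot_coset n \<Omega> p" for q
  proof (rule pot_coset_eq)
    obtain h where "h \<in> carrier (mpoly_algebra (n + 1))" "q = h * \<Omega> + p"
      using q by (auto simp: mem_pot_coset)
    then show "mconst c * q \<in> pot_coset n \<Omega> (mconst c * p)"
      unfolding mem_pot_coset
      by (intro bexI[of _ "mconst c * h"]) (simp_all add: algebra_simps mpoly_closed)
  qed
  then show ?thesis unfolding P_pot_ops(3) using pot_coset_self by blast
qed

section \<open>Homogeneity of the ideal and the graded presentation\<close>

lemma homogeneous_total_degree:
  assumes "homogeneous p" "e \<in> Poly_Mapping.keys p"
  shows "exponent_degree e = total_degree p"
proof -
  obtain d where d: "\<And>e. e \<in> Poly_Mapping.keys p \<Longrightarrow> exponent_degree e = d"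
    using assms(1) by (auto simp: homogeneous_def)
  then have "exponent_degree ` Poly_Mapping.keys p = {d}" using assms(2) by auto
  then show ?thesis using d[OF assms(2)] by (simp add: total_degree_def)
qed

text \<open>The cofactor \<open>v\<close> is the component of \<open>u\<close> of degree
  \<open>d - D\<close>, and \<open>r\<close> is the rest. Then \<open>g - v * \<Omega>\<close> lives
  in degree \<open>d\<close> only, whereas the equal polynomial \<open>r * \<Omega> + h\<close> has
  no term of degree \<open>d\<close>; hence both vanish.\<close>

lemma homogeneous_multiple:
  assumes "\<Omega> \<in> mpoly_homog m 1 D" "u \<in> carrier (mpoly_algebra m)"
    and "g \<in> mpoly_homog m 1 d" "h \<in> mpoly_ge m 1 (d + 1)" "g = u * \<Omega> + h"
  obtains v where "v \<in> carrier (mpoly_algebra m)" "g = v * \<Omega>"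
proof -
  let ?w = "\<lambda>e. int (exponent_degree e)"
  obtain v r where vr: "u = v + r" "Poly_Mapping.keys v = {e \<in> Poly_Mapping.keys u. ?w e + D = d}"
    "Poly_Mapping.keys r = {e \<in> Poly_Mapping.keys u. \<not> ?w e + D = d}"
    using mpoly_decompose[of u "\<lambda>e. ?w e + D = d"] by blast
  have v: "v \<in> carrier (mpoly_algebra m)" using assms(2) vr(2) by (auto simp: mpoly_carrier)
  have deg: "?w e = ?w a + D" if "e = a + b" "b \<in> Poly_Mapping.keys \<Omega>" for e a b
    using assms(1) that by (auto simp: mpoly_homog_def exponent_degree_add)
  have eq: "g - v * \<Omega> = r * \<Omega> + h" using assms(5) vr(1) by (simp add: algebra_simps)
  have "?w e = d" if "e \<in> Poly_Mapping.keys (g - v * \<Omega>)" for e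
  proof -
    from that consider "e \<in> Poly_Mapping.keys g" | "e \<in> Poly_Mapping.keys (v * \<Omega>)"
      using keys_diff[of g "v * \<Omega>"] by blast
    then show ?thesis
    proof cases
      case 1
      then show ?thesis using assms(3) by (simp add: mpoly_homog_def)
    next
      case 2
      then obtain a b where "e = a + b" "a \<in> Poly_Mapping.keys v" "b \<in> Poly_Mapping.keys \<Omega>"
        using keys_mult[of v \<Omega>] by blast
      then show ?thesis using deg[of e a b] vr(2) by simp
    qed
  qed
  moreover have "?w e \<noteq> d" if "e \<in> Poly_Mapping.keys (r * \<Omega> + h)" for e
  proof -
    from that consider "e \<in> Poly_Mapping.keys h" | "e \<in> Poly_Mapping.keys (r * \<Omega>)"
      using keys_add[of "r * \<Omega>" h] by blast
    then show ?thesis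
    proof cases
      case 1
      then show ?thesis using assms(4) by (fastforce simp: mpoly_ge_def)
    next
      case 2
      then obtain a b where "e = a + b" "a \<in> Poly_Mapping.keys r" "b \<in> Poly_Mapping.keys \<Omega>"
        using keys_mult[of r \<Omega>] by blast
      then show ?thesis using deg[of e a b] vr(3) by simp
    qed
  qed
  ultimately have "Poly_Mapping.keys (g - v * \<Omega>) = {}" unfolding eq by blast
  then have "g = v * \<Omega>" by simp
  then show ?thesis using v that by blast
qed

text \<open>The kernel is the ideal of \<open>\<Omega>\<close>, homogeneous by
  \<open>homogeneous_multiple\<close>. The bracket of variables inherits its weight from the
  gradient of \<open>\<Omega>\<close>.\<close>

lemma potential_presentation:
  assumes \<Omega>: "is_potential n \<Omega>" and deg: "total_degree \<Omega> > n + 1"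
    and K: "nambu_poisson_field n K"
    and \<iota>: "\<iota> \<in> nambu_hom n (P_pot n \<Omega>) K" "inj_on \<iota> (carrier (P_pot n \<Omega>))"
    and frac: "\<And>x. x \<in> carrier K \<Longrightarrow> \<exists>a\<in>carrier (P_pot n \<Omega>).
      \<exists>b\<in>carrier (P_pot n \<Omega>) - {\<zero>\<^bsub>P_pot n \<Omega>\<^esub>}. x = \<iota> a \<otimes>\<^bsub>K\<^esub> inv\<^bsub>K\<^esub> (\<iota> b)"
  shows "graded_presentation n K (n + 1) 1 (\<lambda>p. \<iota> (pot_coset n \<Omega> p))"
proof -
  interpret K: nambu_poisson_field n K by (rule K)
  let ?C = "carrier (mpoly_algebra (n + 1)) :: 'a mpoly set"
  let ?D = "int (total_degree \<Omega>)"
  let ?\<pi> = "\<lambda>p. \<iota> (pot_coset n \<Omega> p)"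
  have \<Omega>C: "\<Omega> \<in> ?C" using \<Omega> by (simp add: is_potential_def)
  have \<Omega>h: "\<Omega> \<in> mpoly_homog (n + 1) 1 ?D"
    using \<Omega> homogeneous_total_degree[of \<Omega>] by (auto simp: is_potential_def mpoly_homog_def)
  have "\<iota> \<circ> pot_coset n \<Omega> \<in> ring_hom (mpoly_algebra (n + 1)) K"
    using pot_coset_ring_hom[OF \<Omega>C] \<iota>(1) by (intro ring_hom_trans) (auto simp: nambu_hom_def)
  then have hom: "?\<pi> \<in> ring_hom (mpoly_algebra (n + 1)) K" by (simp add: comp_def)
  have closed: "?\<pi> p \<in> carrier K" if "p \<in> ?C" for p using ring_hom_closed[OF hom that] .
  have zero: "?\<pi> 0 = \<zero>\<^bsub>K\<^esub>"
  proof -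
    have "?\<pi> 0 = ?\<pi> 0 \<oplus>\<^bsub>K\<^esub> ?\<pi> 0"
      using ring_hom_add[OF hom, of 0 0] by (simp add: mpoly_closed mpoly_ops)
    then show ?thesis using closed[of 0] by (simp add: mpoly_closed)
  qed
  \<comment> \<open>Injectivity of \<open>\<iota>\<close> reduces equality in \<open>K\<close> to
    equality of cosets.\<close>
  have inj: "p \<in> pot_coset n \<Omega> q" if "?\<pi> p = ?\<pi> q" "p \<in> ?C" "q \<in> ?C" for p q
    using inj_onD[OF \<iota>(2) that(1)] that(2,3) pot_coset_self by (auto simp: P_pot_ops)
  show ?thesis
  proof
    show "?\<pi> \<in> ring_hom (mpoly_algebra (n + 1)) K" by (rule hom)
    show "?\<pi> (mconst k) = k \<odot>\<^bsub>K\<^esub> \<one>\<^bsub>K\<^esub>" for k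
    proof -
      have "pot_coset n \<Omega> 1 \<in> carrier (P_pot n \<Omega>)" by (simp add: P_pot_ops mpoly_closed)
      then have "\<iota> (k \<odot>\<^bsub>P_pot n \<Omega>\<^esub> pot_coset n \<Omega> 1) = k \<odot>\<^bsub>K\<^esub> ?\<pi> 1"
        using \<iota>(1) by (simp add: nambu_hom_def)
      then show ?thesis using ring_hom_one[OF hom] by (simp add: P_pot_smult mpoly_ops)
    qed
    show "\<exists>p\<in>?C. \<exists>q\<in>?C. ?\<pi> q \<noteq> \<zero>\<^bsub>K\<^esub> \<and> x \<otimes>\<^bsub>K\<^esub> ?\<pi> q = ?\<pi> p" if x: "x \<in> carrier K" for x
    proof -
      obtain p q where pq: "p \<in> ?C" "q \<in> ?C" "pot_coset n \<Omega> q \<noteq> pot_coset n \<Omega> 0"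
          "x = ?\<pi> p \<otimes>\<^bsub>K\<^esub> inv\<^bsub>K\<^esub> (?\<pi> q)"
        using frac[OF x] by (auto simp: P_pot_ops)
      then have "?\<pi> q \<noteq> \<zero>\<^bsub>K\<^esub>" using inj[of q 0] zero pot_coset_eq by (metis mpoly_closed(1))
      moreover from this have "x \<otimes>\<^bsub>K\<^esub> ?\<pi> q = ?\<pi> p"
        using pq closed by (simp add: K.m_assoc K.field_Units)
      ultimately show ?thesis using pq by blast
    qed
    show "?\<pi> g = \<zero>\<^bsub>K\<^esub>"
      if g: "g \<in> mpoly_homog (n + 1) 1 d" and h: "h \<in> mpoly_ge (n + 1) 1 (d + 1)" and eq: "?\<pi> g = ?\<pi> h" for g h d
    proof -
      have "g \<in> pot_coset n \<Omega> h"
        using inj[OF eq] mpoly_graded_carrier(1)[OF h] mpoly_graded_carrier(2)[OF g] by simp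
      then obtain u where "u \<in> ?C" "g = u * \<Omega> + h" by (auto simp: mem_pot_coset)
      then obtain v where "v \<in> ?C" "g = v * \<Omega>" using homogeneous_multiple[OF \<Omega>h _ g h] by blast
      then have "g \<in> pot_coset n \<Omega> 0" by (auto simp: mem_pot_coset)
      then show ?thesis using pot_coset_eq zero by metis
    qed
    show "\<exists>p\<in>mpoly_ge (n + 1) 1 (int n * 1 + 1). bracket K (map (\<lambda>j. ?\<pi> (mvar j)) js) = ?\<pi> p"
      if js: "length js = n" "set js \<subseteq> {..<n + 1}" for js
    proof -
      let ?vs = "map mvar js :: 'a mpoly list"
      have vs: "length ?vs = n" "set ?vs \<subseteq> ?C" using js by (auto simp: mpoly_closed)
      have "bracket (A_pot n \<Omega>) ?vs \<in> mpoly_ge (n + 1) 1 (?D - 1)"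
        by (rule A_pot_bracket_ge[OF vs mpoly_homog_ge[OF \<Omega>h]])
      \<comment> \<open>The strict inequality \<open>total_degree \<Omega> > n + 1\<close> is
        exactly what keeps the degree at \<open>n + 1\<close> or more after one
        differentiation.\<close>
      then have ge: "bracket (A_pot n \<Omega>) ?vs \<in> mpoly_ge (n + 1) 1 (int n * 1 + 1)"
        by (rule mpoly_ge_mono) (use deg in simp)
      have "set (map (pot_coset n \<Omega>) ?vs) \<subseteq> carrier (P_pot n \<Omega>)"
        using vs by (auto simp: P_pot_ops)
      then have "bracket K (map \<iota> (map (pot_coset n \<Omega>) ?vs)) = \<iota> (bracket (P_pot n \<Omega>) (map (pot_coset n \<Omega>) ?vs))"
        using \<iota>(1) vs(1) by (simp add: nambu_hom_def del: map_map)
      also have "\<dots> = ?\<pi> (bracket (A_pot n \<Omega>) ?vs)" using P_pot_bracket[OF vs \<Omega>C] by simp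
      finally show ?thesis using ge by (intro bexI[of _ "bracket (A_pot n \<Omega>) ?vs"]) (simp_all add: comp_def)
    qed
  qed
qed

theorem corollary5p9:
  fixes n :: nat and q :: "'k::field_char_0"
    and N :: "('k, 'k ratfun) nambu" and K :: "('k, 'a) nambu"
  assumes "n \<ge> 3" and "q \<noteq> 0"
    and "is_N_skew n q N"
    and "nambu_poisson_field n K"
  shows "(nontrivial_valuations n (- 1) K \<noteq> {} \<longrightarrow> nambu_hom n N K = {}) \<and>
    ((\<exists>W. is_N_Weyl n W \<and> nambu_isomorphic n W K) \<or>
     (\<exists>\<Omega> d\<^sub>0. is_potential n \<Omega> \<and> total_degree \<Omega> = n + 1 + d\<^sub>0 \<and> total_degree \<Omega> \<noteq> n + 1 \<and>
        is_nambu_fraction_field n (P_pot n \<Omega>) K)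
     \<longrightarrow> nambu_hom n N K = {})"
proof -
  have no_hom: "nambu_hom n N K = {}" if "nambu_filtration n K F" for F
    using nambu_filtration.no_morphism_from_skew[OF that assms(3,2)] .
  have no_hom_presented: "nambu_hom n N K = {}" if "graded_presentation n K m \<epsilon> \<pi>" for m \<epsilon> \<pi>
  proof -
    interpret graded_presentation n K m \<epsilon> \<pi> by (rule that)
    show ?thesis by (rule no_hom) unfold_locales
  qed
  have "nambu_hom n N K = {}" if "\<nu> \<in> nontrivial_valuations n (- 1) K" for \<nu>
    using that no_hom[OF nambu_poisson_field.valuation_filtration[OF assms(4)]]
    unfolding nontrivial_valuations_def by blast
  moreover have "nambu_hom n N K = {}" if "is_N_Weyl n W" "nambu_isomorphic n W K" for W
    using that no_hom_presented[OF Weyl_presentation[OF _ that(1) assms(4)]] assms(1)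
    by (auto simp: nambu_isomorphic_def)
  moreover have "nambu_hom n N K = {}"
    if "is_potential n \<Omega>" "total_degree \<Omega> = n + 1 + d" "total_degree \<Omega> \<noteq> n + 1"
      and Q: "is_nambu_fraction_field n (P_pot n \<Omega>) K" for \<Omega> d
  proof -
    \<comment> \<open>The degree is \<open>n + 1 + d\<close> with natural \<open>d\<close> and
      differs from \<open>n + 1\<close>, so \<open>d\<close> is positive.\<close>
    have deg: "n + 1 < total_degree \<Omega>" using that(2,3) by simp
    obtain \<iota> where "\<iota> \<in> nambu_hom n (P_pot n \<Omega>) K" "inj_on \<iota> (carrier (P_pot n \<Omega>))"
      "\<And>x. x \<in> carrier K \<Longrightarrow> \<exists>a\<in>carrier (P_pot n \<Omega>).
        \<exists>b\<in>carrier (P_pot n \<Omega>) - {\<zero>\<^bsub>P_pot n \<Omega>\<^esub>}. x = \<iota> a \<otimes>\<^bsub>K\<^esub> inv\<^bsub>K\<^esub> (\<iota> b)"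
      using Q unfolding is_nambu_fraction_field_def by blast
    then show ?thesis
      by (rule no_hom_presented[OF potential_presentation[OF that(1) deg assms(4)]])
  qed
  ultimately show ?thesis by blast
qed

end
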